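(* Let $\mathbb{F}$ be a field. Up to isomorphism there is a unique nilpotent symplectic alternating algebra $L$ over $\mathbb{F}$ of dimension $10$ that has an isotropic center $Z(L)$ of dimension $4$ and for which $L^{3}$ is properly contained in $Z(L)$. This algebra can be given by the nilpotent presentation $$\mathcal{P}_{10}^{(4,1)}:\ (y_{2}y_{3},y_{4})=1,\ (y_{1}y_{4},y_{5})=1,\ (x_{1}y_{3},y_{5})=1.$$
   Context: A symplectic alternating algebra (SAA) over a field $\mathbb{F}$ is a finite-dimensional $\mathbb{F}$-vector space $L$ with a non-degenerate alternating bilinear form $(\cdot,\cdot)$ and a bilinear alternating product $L\times L\to L$, $(x,y)\mapsto xy$ (so $xx=0$), such that $(xy,z)=(yz,x)$ for all $x,y,z\in L$. Consequently $(u,v,w)\mapsto (uv,w)$ is an alternating trilinear form, and by non-degeneracy it determines the product. An isomorphism of SAAs is a linear bijection preserving both the product and the form. For subspaces $U,V\le L$, $UV$ denotes the linear span of all products $uv$ with $u\in U$, $v\in V$. Put $L^{1}=L$, $L^{k+1}=L^{k}L$; $L$ is nilpotent if $L^{k+1}=0$ for some $k$. The center is $Z(L)=\{z\in L: zx=0 \text{ for all } x\in L\}$. A subspace $U$ is isotropic if $(u,v)=0$ for all $u,v\in U$. A standard basis of a $10$-dimensional $L$ is a basis $x_{1},y_{1},\ldots,x_{5},y_{5}$ with $(x_i,x_j)=(y_i,y_j)=0$ and $(x_i,y_j)=\delta_{ij}$. A nilpotent presentation lists values of the triples $(x_iy_j,y_k)$ and $(y_iy_j,y_k)$ with $1\le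 i<j<k\le 5$ with respect to a standard basis. By convention, all triple values $(uv,w)$ of basis vectors $u,v,w$ which do not follow from the listed ones by the alternating property are $0$. Such a presentation determines an SAA up to isomorphism. *)

theory Defs
  imports "HOL-Analysis.Cartesian_Space"
begin

text \<open>
  The underlying vector space is a whole type 'v with an explicit scalar multiplication over
  an arbitrary field 'f.
\<close>

locale symplectic_alternating_algebra = vector_space scale
  for scale :: "'f::field \<Rightarrow> 'v::ab_group_add \<Rightarrow> 'v" +
  fixes form :: "'v \<Rightarrow> 'v \<Rightarrow> 'f"
    and mul :: "'v \<Rightarrow> 'v \<Rightarrow> 'v"  (infixl "\<bullet>\<^sub>L" 70)
  assumes finite_dim: "\<exists>B. finite B \<and> span B = UNIV"
    and form_linear_left: "Vector_Spaces.linear scale (*) (\<lambda>x. form x y)"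
    and form_linear_right: "Vector_Spaces.linear scale (*) (\<lambda>y. form x y)"
    and form_alternating: "form x x = 0"
    and form_nondegenerate: "(\<And>y. form x y = 0) \<Longrightarrow> x = 0"
    and mul_linear_left: "Vector_Spaces.linear scale scale (\<lambda>x. x \<bullet>\<^sub>L y)"
    and mul_linear_right: "Vector_Spaces.linear scale scale (\<lambda>y. x \<bullet>\<^sub>L y)"
    and mul_alternating: "x \<bullet>\<^sub>L x = 0"
    and form_mul_cyclic: "form (x \<bullet>\<^sub>L y) z = form (y \<bullet>\<^sub>L z) x"

definition saa_isomorphic ::
  "('f::field \<Rightarrow> 'v::ab_group_add \<Rightarrow> 'v) \<Rightarrow> ('v \<Rightarrow> 'v \<Rightarrow> 'f) \<Rightarrow> ('v \<Rightarrow> 'v \<Rightarrow> 'v) \<Rightarrow>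
   ('f \<Rightarrow> 'w::ab_group_add \<Rightarrow> 'w) \<Rightarrow> ('w \<Rightarrow> 'w \<Rightarrow> 'f) \<Rightarrow> ('w \<Rightarrow> 'w \<Rightarrow> 'w) \<Rightarrow> bool" where
  "saa_isomorphic sc form mul sc' form' mul' \<longleftrightarrow>
     (\<exists>\<phi>. Vector_Spaces.linear sc sc' \<phi> \<and> bij \<phi> \<and>
        (\<forall>x y. \<phi> (mul x y) = mul' (\<phi> x) (\<phi> y)) \<and>
        (\<forall>x y. form' (\<phi> x) (\<phi> y) = form x y))"

text \<open>
  Names for the elements of a standard basis, and presentations as lists of triples with
  their prescribed values: the entry ((u, v, w), c) stands for (uv, w) = c.
\<close>

datatype letter = X nat | Y nat

type_synonym 'f presentation = "((letter \<times> letter \<times> letter) \<times> 'f) list"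

definition letters :: "nat \<Rightarrow> letter set" where
  "letters n = X ` {1..n} \<union> Y ` {1..n}"

definition nilpotent_triple :: "nat \<Rightarrow> letter \<times> letter \<times> letter \<Rightarrow> bool" where
  "nilpotent_triple n t \<longleftrightarrow>
     (\<exists>i j k. 1 \<le> i \<and> i < j \<and> j < k \<and> k \<le> n \<and> (t = (X i, Y j, Y k) \<or> t = (Y i, Y j, Y k)))"

definition nilpotent_presentation :: "nat \<Rightarrow> 'f presentation \<Rightarrow> bool" where
  "nilpotent_presentation n P \<longleftrightarrow>
     distinct (map fst P) \<and> (\<forall>(t, c) \<in> set P. nilpotent_triple n t)"

context symplectic_alternating_algebra
begin

definition subspace_product :: "'v set \<Rightarrow> 'v set \<Rightarrow> 'v set" where
  "subspace_product U V = span {u \<bullet>\<^sub>L v | u v. u \<in> U \<and> v \<in> V}"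

text \<open>Powers are indexed from 1; the value at 0 is a dummy.\<close>

fun lower_power :: "nat \<Rightarrow> 'v set" where
  "lower_power 0 = UNIV"
| "lower_power (Suc 0) = UNIV"
| "lower_power (Suc (Suc k)) = subspace_product (lower_power (Suc k)) UNIV"

definition nilpotent :: bool where
  "nilpotent \<longleftrightarrow> (\<exists>k. lower_power (k + 1) = {0})"

definition center :: "'v set" where
  "center = {z. \<forall>x. z \<bullet>\<^sub>L x = 0}"

definition isotropic :: "'v set \<Rightarrow> bool" where
  "isotropic U \<longleftrightarrow> (\<forall>u\<in>U. \<forall>v\<in>U. form u v = 0)"

definition standard_basis :: "nat \<Rightarrow> (letter \<Rightarrow> 'v) \<Rightarrow> bool" where
  "standard_basis n e \<longleftrightarrow>
     inj_on e (letters n) \<and> independent (e ` letters n) \<and> span (e ` letters n) = UNIV \<and>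
     (\<forall>i\<in>{1..n}. \<forall>j\<in>{1..n}.
        form (e (X i)) (e (X j)) = 0 \<and> form (e (Y i)) (e (Y j)) = 0 \<and>
        form (e (X i)) (e (Y j)) = (if i = j then 1 else 0))"

text \<open>
  The letters of a listed triple are pairwise distinct, so {u, v, w} = {u', v', w'} says that
  (u, v, w) is a rearrangement of the listed triple (u', v', w'), i.e. that its value follows
  from the listed one by the alternating property; all other values vanish.
\<close>

definition has_nilpotent_presentation :: "nat \<Rightarrow> 'f presentation \<Rightarrow> bool" where
  "has_nilpotent_presentation n P \<longleftrightarrow>
     nilpotent_presentation n P \<and>
     (\<exists>e. standard_basis n e \<and>
        (\<forall>((u, v, w), c) \<in> set P. form (e u \<bullet>\<^sub>L e v) (e w) = c) \<and>
        (\<forall>u \<in> letters n. \<forall>v \<in> letters n. \<forall>w \<in> letters n.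
           (\<nexists>u' v' w' c. ((u', v', w'), c) \<in> set P \<and> {u, v, w} = {u', v', w'}) \<longrightarrow>
           form (e u \<bullet>\<^sub>L e v) (e w) = 0))"

end

definition nilpotent_saa_10_4_1 ::
  "('f::field \<Rightarrow> 'v::ab_group_add \<Rightarrow> 'v) \<Rightarrow> ('v \<Rightarrow> 'v \<Rightarrow> 'f) \<Rightarrow> ('v \<Rightarrow> 'v \<Rightarrow> 'v) \<Rightarrow> bool" where
  "nilpotent_saa_10_4_1 sc form mul \<longleftrightarrow>
     symplectic_alternating_algebra sc form mul \<and>
     symplectic_alternating_algebra.nilpotent sc mul \<and>
     vector_space.dim sc (UNIV :: 'v set) = 10 \<and>
     symplectic_alternating_algebra.isotropic form (symplectic_alternating_algebra.center mul) \<and>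
     vector_space.dim sc (symplectic_alternating_algebra.center mul) = 4 \<and>
     symplectic_alternating_algebra.lower_power sc mul 3
       \<subset> symplectic_alternating_algebra.center mul"

definition P10_4_1 :: "'f::field presentation" where
  "P10_4_1 = [((Y 2, Y 3, Y 4), 1), ((Y 1, Y 4, Y 5), 1), ((X 1, Y 3, Y 5), 1)]"

end

(*
  Write T(x, y, z) = (xy, z) and Z for the center. Then L^2 is the orthogonal complement of Z, so
  T(u, v, -) = 0 for u, v in L^2 because L^3 lies in Z. Choose u, v in L^2 with (u, v) = 1 spanning
  L^2 modulo Z, and y2 orthogonal to L^3 but not to Z; then T(u, y2, -) = T(v, y2, -) = 0. Hence
  T(u, -, -) and T(v, -, -) are alternating forms on a three-dimensional space spanned by y3, y4, y5,
  and they are linearly independent since no combination of u and v is central. Their radicals are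
  two different lines; taking suitable generators of these lines as y4 and y3 brings both forms to
  normal form, and subtracting multiples of u and v from y2 and y3 and rescaling y2 removes the
  remaining parameters.
  As T only depends on vectors modulo Z, the result can be corrected by central elements to a
  standard basis.
*)
theory Submission
  imports Defs
begin

text \<open>The normalisation takes place modulo Z, where T is well defined but the form is not. The
  relations of a standard basis are restored afterwards by adding central vectors; what must be kept
  until then is (u, v) = 1 with u, v orthogonal to Z, and the independence of y2, ..., y5 modulo the
  complement of Z. The radicals p of T(u, -, -) and q of T(v, -, -) depend linearly on the
  coefficients of these forms, so s u + t v has the vector s p + t q in its radical. The mixed term
  of this identity is T(u, q, -) = - T(v, p, -). Hence a single nonzero value m = T(u, q, y5)
  normalises both forms, with y3 = q / m and y4 = - p / m; no roots are extracted, so the field may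
  be arbitrary. The last parameter T(y2, y3, y4) can be scaled to 1 because it is nonzero: otherwise
  y2 would be central, hence orthogonal to Z. The convention that unlisted values vanish is replaced
  by one formula for T, a sum of three 3x3 determinants in coordinates. Isomorphism and the axioms
  of the concrete model then become statements about coordinates.\<close>

context symplectic_alternating_algebra
begin

section \<open>Calculus of the form, the product and the trilinear form\<close>

lemma form_add_left: "form (x + x') y = form x y + form x' y"
  using form_linear_left by (simp add: Vector_Spaces.linear_iff)

lemma form_scale_left: "form (scale c x) y = c * form x y"
  using form_linear_left by (simp add: Vector_Spaces.linear_iff)

lemma form_add_right: "form x (y + y') = form x y + form x y'"
  using form_linear_right by (simp add: Vector_Spaces.linear_iff)

lemma form_scale_right: "form x (scale c y) = c * form x y"
  using form_linear_right by (simp add: Vector_Spaces.linear_iff)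

lemma mul_add_left: "(x + x') \<bullet>\<^sub>L y = x \<bullet>\<^sub>L y + x' \<bullet>\<^sub>L y"
  using mul_linear_left by (simp add: Vector_Spaces.linear_iff)

lemma mul_scale_left: "(scale c x) \<bullet>\<^sub>L y = scale c (x \<bullet>\<^sub>L y)"
  using mul_linear_left by (simp add: Vector_Spaces.linear_iff)

lemma mul_add_right: "x \<bullet>\<^sub>L (y + y') = x \<bullet>\<^sub>L y + x \<bullet>\<^sub>L y'"
  using mul_linear_right by (simp add: Vector_Spaces.linear_iff)

lemma mul_scale_right: "x \<bullet>\<^sub>L (scale c y) = scale c (x \<bullet>\<^sub>L y)"
  using mul_linear_right by (simp add: Vector_Spaces.linear_iff)

lemmas bilinear_simps =
  form_add_left form_scale_left form_add_right form_scale_right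
  mul_add_left mul_scale_left mul_add_right mul_scale_right

lemma form_zero [simp]: "form 0 y = 0" "form x 0 = 0"
  using form_scale_left[of 0 0 y] form_scale_right[of x 0 0] by simp_all

lemma mul_zero [simp]: "0 \<bullet>\<^sub>L y = 0" "x \<bullet>\<^sub>L 0 = 0"
  using mul_scale_left[of 0 0 y] mul_scale_right[of x 0 0] by simp_all

lemma form_sum_left: "form (\<Sum>i\<in>A. g i) y = (\<Sum>i\<in>A. form (g i) y)"
  by (induction A rule: infinite_finite_induct) (simp_all add: form_add_left)

lemma form_sum_right: "form x (\<Sum>i\<in>A. g i) = (\<Sum>i\<in>A. form x (g i))"
  by (induction A rule: infinite_finite_induct) (simp_all add: form_add_right)

lemma form_minus: "form (- x) y = - form x y" "form x (- y) = - form x y"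
  using form_scale_left[of "-1" x y] form_scale_right[of x "-1" y] by simp_all

lemma form_diff_left: "form (x - x') y = form x y - form x' y"
  using form_add_left[of x "- x'" y] by (simp add: form_minus)

lemma form_diff_right: "form x (y - y') = form x y - form x y'"
  using form_add_right[of x y "- y'"] by (simp add: form_minus)

lemma form_antisym: "form y x = - form x y"
proof -
  have "form (x + y) (x + y) = 0" by (rule form_alternating)
  then have "form y x + form x y = 0"
    unfolding bilinear_simps by (simp add: form_alternating add.commute)
  then show ?thesis
    by (simp add: eq_neg_iff_add_eq_0)
qed

text \<open>This is the form T of the overview. By nondegeneracy it determines the product, so the
  product is studied through it.\<close>

definition tri :: "'v \<Rightarrow> 'v \<Rightarrow> 'v \<Rightarrow> 'f" where
  "tri x y z = form (x \<bullet>\<^sub>L y) z"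

lemma tri_linear:
  "tri (x + x') y z = tri x y z + tri x' y z"
  "tri x (y + y') z = tri x y z + tri x y' z"
  "tri x y (z + z') = tri x y z + tri x y z'"
  "tri (scale c x) y z = c * tri x y z"
  "tri x (scale c y) z = c * tri x y z"
  "tri x y (scale c z) = c * tri x y z"
  by (simp_all add: tri_def bilinear_simps)

lemma tri_zero [simp]: "tri 0 y z = 0" "tri x 0 z = 0" "tri x y 0 = 0"
  by (simp_all add: tri_def)

lemma tri_minus: "tri (- x) y z = - tri x y z" "tri x (- y) z = - tri x y z"
  "tri x y (- z) = - tri x y z"
  using tri_linear(4)[of "-1" x y z] tri_linear(5)[of x "-1" y z] tri_linear(6)[of x y "-1" z]
  by simp_all

lemma tri_diff: "tri (x - x') y z = tri x y z - tri x' y z"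
  "tri x (y - y') z = tri x y z - tri x y' z"
  "tri x y (z - z') = tri x y z - tri x y z'"
  using tri_linear(1)[of x "- x'" y z] tri_linear(2)[of x y "- y'" z] tri_linear(3)[of x y z "- z'"]
  by (simp_all add: tri_minus)

lemma tri_cycle: "tri x y z = tri y z x"
  unfolding tri_def by (rule form_mul_cyclic)

lemma tri_same [simp]: "tri x x z = 0" "tri x z x = 0" "tri z x x = 0"
proof -
  show *: "tri x x z = 0" for x z
    by (simp add: tri_def mul_alternating)
  show "tri z x x = 0"
    using tri_cycle[of z x x] * by simp
  show "tri x z x = 0"
    using tri_cycle[of x x z] * by simp
qed

lemma tri_swap: "tri y x z = - tri x y z"
proof -
  have "tri (x + y) (x + y) z = 0" by simp
  then have "tri y x z + tri x y z = 0"
    unfolding tri_linear by (simp add: add.commute)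
  then show ?thesis
    by (simp add: eq_neg_iff_add_eq_0)
qed

lemma tri_swap_right: "tri x z y = - tri x y z"
  using tri_cycle[of x z y] tri_cycle[of z y x] tri_swap[of y x z] tri_cycle[of x y z] by simp

lemma tri_perms: "tri y z x = tri x y z" "tri z x y = tri x y z"
  "tri y x z = - tri x y z" "tri z y x = - tri x y z" "tri x z y = - tri x y z"
  using tri_cycle[of x y z] tri_cycle[of y z x] tri_swap[of y x z] tri_swap[of z y x]
    tri_swap_right[of x z y] by simp_all

lemma center_iff: "x \<in> center \<longleftrightarrow> (\<forall>y z. tri x y z = 0)"
  unfolding center_def tri_def using form_nondegenerate by fastforce

lemma subspace_center: "subspace center"
  by (rule subspaceI) (auto simp: center_iff tri_linear)

section \<open>Orthogonal complements and dual families\<close>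

definition orth :: "'v set \<Rightarrow> 'v set" where
  "orth U = {x. \<forall>u\<in>U. form u x = 0}"

lemma subspace_orth: "subspace (orth U)"
  by (rule subspaceI) (auto simp: orth_def bilinear_simps)

lemma orth_span: "orth (span U) = orth U"
proof -
  have "form u x = 0" if "\<forall>u\<in>U. form u x = 0" "u \<in> span U" for u x
    using that(2) by (induction rule: span_induct_alt) (auto simp: bilinear_simps that(1))
  then show ?thesis
    unfolding orth_def using span_base by blast
qed

lemma form_span_eq_0:
  assumes "\<And>u. u \<in> U \<Longrightarrow> form u x = 0" "u \<in> span U"
  shows "form u x = 0"
  using assms orth_span[of U] unfolding orth_def by blast

text \<open>Gram-Schmidt for functionals, by induction on the index set: a new functional is not a
  combination of the old ones on \<open>S\<close>, so some vector of \<open>S\<close> detects it and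
  can be corrected to be dual to it. The subspace \<open>S\<close> is kept general because partners
  inside the center are needed later.\<close>

lemma dual_family:
  fixes f :: "'i \<Rightarrow> 'v \<Rightarrow> 'f"
  assumes "finite I" and S: "subspace S"
    and add: "\<And>i x y. i \<in> I \<Longrightarrow> f i (x + y) = f i x + f i y"
    and scl: "\<And>i c x. i \<in> I \<Longrightarrow> f i (scale c x) = c * f i x"
    and indep: "\<And>c i. (\<And>s. s \<in> S \<Longrightarrow> (\<Sum>i\<in>I. c i * f i s) = 0) \<Longrightarrow> i \<in> I \<Longrightarrow> c i = 0"
  shows "\<exists>s. \<forall>j\<in>I. s j \<in> S \<and> (\<forall>i\<in>I. f i (s j) = (if i = j then 1 else 0))"
  using assms(1) add scl indep
proof (induction I)
  case empty
  then show ?case by simp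
next
  case (insert k I)
  have indI: "c i = 0" if "\<And>s. s \<in> S \<Longrightarrow> (\<Sum>i\<in>I. c i * f i s) = 0" "i \<in> I" for c i
  proof -
    have "(\<Sum>i\<in>insert k I. (c(k := 0)) i * f i s) = (\<Sum>i\<in>I. c i * f i s)" for s
      using insert.hyps by (auto intro!: sum.cong)
    then have "(c(k := 0)) i = 0"
      using insert.prems(3)[of "c(k := 0)" i] that by auto
    then show ?thesis
      using that insert.hyps by (auto split: if_splits)
  qed
  obtain s where s: "\<And>j. j \<in> I \<Longrightarrow> s j \<in> S"
    "\<And>i j. i \<in> I \<Longrightarrow> j \<in> I \<Longrightarrow> f i (s j) = (if i = j then 1 else 0)"
  proof -
    have "\<exists>s. \<forall>j\<in>I. s j \<in> S \<and> (\<forall>i\<in>I. f i (s j) = (if i = j then 1 else 0))"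
      by (rule insert.IH) (use insert.prems(1,2) indI in blast)+
    then show ?thesis using that by blast
  qed
  \<comment> \<open>These are the coefficients of \<open>f k\<close> minus its expansion in the old
    functionals, with \<open>f k (s i)\<close> as the coefficient of \<open>f i\<close>. As
    \<open>c k = 1\<close>, independence makes the combination nonzero somewhere on
    \<open>S\<close>.\<close>
  define c where "c i = (if i = k then 1 else - f k (s i))" for i
  have "\<exists>t\<in>S. (\<Sum>i\<in>insert k I. c i * f i t) \<noteq> 0"
    using insert.prems(3)[of c k] by (auto simp: c_def)
  then obtain t where t: "t \<in> S" "(\<Sum>i\<in>insert k I. c i * f i t) \<noteq> 0" by blast
  have f0: "f i 0 = 0" if "i \<in> insert k I" for i
    using insert.prems(2)[OF that, of 0 0] by simp
  have fminus: "f i (x - y) = f i x - f i y" if "i \<in> insert k I" for i x y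
    using insert.prems(1)[OF that, of "x - y" y] by simp
  have fsum: "f i (\<Sum>j\<in>J. g j) = (\<Sum>j\<in>J. f i (g j))" if "i \<in> insert k I" for i J g
    by (induction J rule: infinite_finite_induct) (simp_all add: f0[OF that] insert.prems(1)[OF that])
  \<comment> \<open>Removing the components along the old dual vectors kills every
    \<open>f i\<close> with \<open>i\<close> in \<open>I\<close>, while \<open>f k\<close> takes at
    \<open>t1\<close> exactly the nonzero value of the combination at \<open>t\<close>.\<close>
  define t1 where "t1 = t - (\<Sum>j\<in>I. scale (f j t) (s j))"
  have t1S: "t1 \<in> S"
    unfolding t1_def using S s t by (intro subspace_diff subspace_sum subspace_scale) auto
  have t1I: "f i t1 = 0" if "i \<in> I" for i
    using that insert.hyps
    by (simp add: t1_def fminus fsum insert.prems(2) s if_distrib cong: if_cong)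
  have t1k: "f k t1 \<noteq> 0"
  proof -
    have "f k t1 = f k t - (\<Sum>i\<in>I. f i t * f k (s i))"
      by (simp add: t1_def fminus fsum insert.prems(2))
    also have "(\<Sum>i\<in>I. f i t * f k (s i)) = - (\<Sum>i\<in>I. c i * f i t)"
      unfolding sum_negf[symmetric] using insert.hyps by (intro sum.cong) (auto simp: c_def)
    also have "f k t - - (\<Sum>i\<in>I. c i * f i t) = (\<Sum>i\<in>insert k I. c i * f i t)"
      using insert.hyps by (simp add: c_def)
    finally have "f k t1 = (\<Sum>i\<in>insert k I. c i * f i t)" .
    with t(2) show ?thesis by simp
  qed
  define t2 where "t2 = scale (inverse (f k t1)) t1"
  have t2: "t2 \<in> S" "f k t2 = 1" "\<And>i. i \<in> I \<Longrightarrow> f i t2 = 0"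
    using t1S t1k t1I S by (auto simp: t2_def insert.prems(2) subspace_scale)
  \<comment> \<open>The old dual vectors may still have a nonzero value under \<open>f k\<close>; a
    multiple of \<open>t2\<close> repairs this without touching the other functionals.\<close>
  define s' where "s' j = (if j = k then t2 else s j - scale (f k (s j)) t2)" for j
  have "s' j \<in> S" if "j \<in> insert k I" for j
    using that s t2 S by (auto simp: s'_def intro!: subspace_diff subspace_scale)
  moreover have "f i (s' j) = (if i = j then 1 else 0)" if "i \<in> insert k I" "j \<in> insert k I" for i j
    using that insert.hyps s t2 by (auto simp: s'_def fminus insert.prems(2))
  ultimately show ?case by blast
qed

text \<open>Specialises to pairings with vectors; the last hypothesis is independence of the
  \<open>g i\<close> modulo the orthogonal complement of \<open>S\<close>.\<close>

lemma dual_vectors: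
  assumes "finite I" "subspace S"
    and "\<And>c i. (\<And>s. s \<in> S \<Longrightarrow> form (\<Sum>i\<in>I. scale (c i) (g i)) s = 0) \<Longrightarrow> i \<in> I \<Longrightarrow> c i = 0"
  obtains s where "\<And>j. j \<in> I \<Longrightarrow> s j \<in> S"
    "\<And>i j. i \<in> I \<Longrightarrow> j \<in> I \<Longrightarrow> form (g i) (s j) = (if i = j then 1 else 0)"
proof -
  have "\<exists>s. \<forall>j\<in>I. s j \<in> S \<and> (\<forall>i\<in>I. form (g i) (s j) = (if i = j then 1 else 0))"
    by (rule dual_family[OF assms(1,2), of "\<lambda>i. form (g i)"])
      (use assms(3) in \<open>auto simp: form_sum_left bilinear_simps\<close>)
  then show ?thesis using that by blast
qed

lemma finite_independent: "independent B \<Longrightarrow> finite B"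
  using finite_dim independent_span_bound by (metis subset_UNIV)

text \<open>By nondegeneracy, a relation among the functionals \<open>form b\<close> is a relation
  among the vectors \<open>b\<close> themselves.\<close>

lemma dual_basis:
  assumes "independent B"
  obtains s where "\<And>b b'. b \<in> B \<Longrightarrow> b' \<in> B \<Longrightarrow> form b (s b') = (if b = b' then 1 else 0)"
proof (rule dual_vectors[of B UNIV "\<lambda>b. b"])
  fix c i assume "\<And>s. s \<in> UNIV \<Longrightarrow> form (\<Sum>i\<in>B. scale (c i) i) s = 0" "i \<in> B"
  then show "c i = 0"
    using form_nondegenerate assms independentD[OF assms finite_independent[OF assms] subset_refl]
    by auto
qed (use finite_independent assms that in auto)

text \<open>Extend a basis of \<open>U\<close> by \<open>p\<close>; the dual vector belonging to
  \<open>p\<close> pairs to zero with \<open>U\<close>.\<close>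

lemma separation:
  assumes U: "subspace U" and p: "p \<notin> U"
  obtains y where "form p y = 1" "y \<in> orth U"
proof -
  obtain B where B: "B \<subseteq> U" "independent B" "U \<subseteq> span B"
    by (rule basis_exists)
  have sp: "span B = U"
    using B(3) span_minimal[OF B(1) U] by (rule subset_antisym[rotated])
  have "p \<notin> span B"
    using p sp by simp
  then have ind: "independent (insert p B)"
    using B(2) by (rule independent_insertI)
  obtain s where s: "\<And>b b'. b \<in> insert p B \<Longrightarrow> b' \<in> insert p B \<Longrightarrow> form b (s b') = (if b = b' then 1 else 0)"
    using dual_basis[OF ind] by metis
  have "form b (s p) = 0" if "b \<in> B" for b
    using s[of b p] that B(1) p by auto
  then have "s p \<in> orth (span B)"
    unfolding orth_span by (simp add: orth_def)
  moreover have "form p (s p) = 1"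
    using s[of p p] by simp
  ultimately show ?thesis
    using that[of "s p"] sp by simp
qed

text \<open>A product pairs with z through T(z, x, y), so the vectors orthogonal to all products are
  exactly the central ones. For the reverse inclusion, \<open>separation\<close> supplies a vector
  orthogonal to \<open>lower_power 2\<close> but not to \<open>p\<close>; it is central, so
  \<open>p\<close> is not orthogonal to the center.\<close>

lemma derived_eq_orth_center: "lower_power 2 = orth center"
proof
  have l2: "lower_power 2 = span {u \<bullet>\<^sub>L v | u v. True}"
    by (simp add: numeral_2_eq_2 subspace_product_def)
  have "form z (u \<bullet>\<^sub>L v) = 0" if "z \<in> center" for z u v
  proof -
    have "form (u \<bullet>\<^sub>L v) z = tri z u v"
      unfolding tri_def[symmetric] by (rule tri_perms(1))
    also have "\<dots> = 0" using that unfolding center_iff by blast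
    finally show ?thesis
      by (subst form_antisym) simp
  qed
  then have "{u \<bullet>\<^sub>L v | u v. True} \<subseteq> orth center"
    by (auto simp: orth_def)
  then show "lower_power 2 \<subseteq> orth center"
    unfolding l2 by (rule span_minimal) (rule subspace_orth)
  show "orth center \<subseteq> lower_power 2"
  proof
    fix p assume p: "p \<in> orth center"
    show "p \<in> lower_power 2"
    proof (rule ccontr)
      assume "p \<notin> lower_power 2"
      then obtain y where y: "form p y = 1" "y \<in> orth (lower_power 2)"
        using separation[of "lower_power 2" p] subspace_span[of "{u \<bullet>\<^sub>L v | u v. True}"]
        unfolding l2 by blast
      then have "tri u v y = 0" for u v
        unfolding l2 orth_span by (auto simp: orth_def tri_def)
      then have "y \<in> center"
        unfolding center_iff tri_cycle[of y] by simp
      then show False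
        using p y(1) form_antisym[of p y] unfolding orth_def by fastforce
    qed
  qed
qed

end

section \<open>The presentation as an explicit alternating form in coordinates\<close>

definition det3 :: "letter \<Rightarrow> letter \<Rightarrow> letter \<Rightarrow>
    (letter \<Rightarrow> 'f::field) \<Rightarrow> (letter \<Rightarrow> 'f) \<Rightarrow> (letter \<Rightarrow> 'f) \<Rightarrow> 'f" where
  "det3 a b c f g h = f a * (g b * h c - g c * h b) - f b * (g a * h c - g c * h a)
    + f c * (g a * h b - g b * h a)"

text \<open>Each \<open>det3 a b c\<close> is the wedge product of three coordinate functionals,
  that is, a 3x3 minor of the coordinate rows. One minor per listed triple gives the alternating
  trilinear form with the listed values and zeros elsewhere, so the zero convention needs no case
  distinction.\<close>

definition shape :: "(letter \<Rightarrow> 'f::field) \<Rightarrow> (letter \<Rightarrow> 'f) \<Rightarrow> (letter \<Rightarrow> 'f) \<Rightarrow> 'f" where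
  "shape f g h = det3 (Y 2) (Y 3) (Y 4) f g h + det3 (Y 1) (Y 4) (Y 5) f g h
    + det3 (X 1) (Y 3) (Y 5) f g h"

lemma set_eq_perm3:
  assumes "{u, v, w} = {a, b, c}" "distinct [a, b, c]"
  shows "(u, v, w) \<in> {(a,b,c), (b,c,a), (c,a,b), (b,a,c), (c,b,a), (a,c,b)}"
proof -
  have "card {u, v, w} = 3"
    using assms by simp
  then have "u \<noteq> v" "u \<noteq> w" "v \<noteq> w"
    by (auto simp: card_insert_if split: if_splits)
  moreover have "u = a \<or> u = b \<or> u = c" "v = a \<or> v = b \<or> v = c" "w = a \<or> w = b \<or> w = c"
    using assms(1) by blast+
  ultimately show ?thesis
    by (elim disjE) simp_all
qed

text \<open>A minor of three Kronecker rows is nonzero only if it is a permutation matrix. Only the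
  values on \<open>a\<close>, \<open>b\<close>, \<open>c\<close> are constrained, because
  \<open>coord\<close> is controlled only on the letters of the frame.\<close>

lemma det3_kronecker:
  fixes f g h :: "letter \<Rightarrow> 'f::field"
  assumes "\<And>l. l \<in> {a, b, c} \<Longrightarrow> f l = (if u = l then 1 else 0)"
    "\<And>l. l \<in> {a, b, c} \<Longrightarrow> g l = (if v = l then 1 else 0)"
    "\<And>l. l \<in> {a, b, c} \<Longrightarrow> h l = (if w = l then 1 else 0)"
    and "distinct [a, b, c]" "{u, v, w} \<noteq> {a, b, c}"
  shows "det3 a b c f g h = 0"
proof -
  have f: "f a = (if u = a then 1 else 0)" "f b = (if u = b then 1 else 0)" "f c = (if u = c then 1 else 0)"
    and g: "g a = (if v = a then 1 else 0)" "g b = (if v = b then 1 else 0)" "g c = (if v = c then 1 else 0)"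
    and h: "h a = (if w = a then 1 else 0)" "h b = (if w = b then 1 else 0)" "h c = (if w = c then 1 else 0)"
    using assms(1-3) by simp_all
  show ?thesis
    using assms(4,5) unfolding det3_def f g h by (auto split: if_splits)
qed

lemma finite_letters [simp]: "finite (letters n)"
  by (simp add: letters_def)

lemma card_letters: "card (letters n) = 2 * n"
proof -
  have "card (X ` {1..n} \<union> Y ` {1..n}) = card (X ` {1..n}) + card (Y ` {1..n})"
    by (rule card_Un_disjoint) auto
  then show ?thesis
    by (simp add: letters_def card_image inj_on_def)
qed

lemma letters_5: "letters 5 = {X 1, X 2, X 3, X 4, X 5, Y 1, Y 2, Y 3, Y 4, Y 5}"
proof -
  have "{1..5::nat} = {1, 2, 3, 4, 5}" by auto
  then show ?thesis by (auto simp: letters_def)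
qed

section \<open>Symplectic frames, coordinates and standard bases\<close>

context symplectic_alternating_algebra
begin

text \<open>Only the pairings are recorded; that the vectors form a basis follows from the dimension
  in \<open>standard_basisI\<close>.\<close>

definition symplectic_frame :: "nat \<Rightarrow> (letter \<Rightarrow> 'v) \<Rightarrow> bool" where
  "symplectic_frame n e \<longleftrightarrow> (\<forall>i\<in>{1..n}. \<forall>j\<in>{1..n}.
     form (e (X i)) (e (X j)) = 0 \<and> form (e (Y i)) (e (Y j)) = 0 \<and>
     form (e (X i)) (e (Y j)) = (if i = j then 1 else 0))"

text \<open>Coordinates are read off by pairing with the partner letter. The order of the arguments
  differs in the two cases so that both coefficients come out with a positive sign.\<close>

definition coord :: "(letter \<Rightarrow> 'v) \<Rightarrow> 'v \<Rightarrow> letter \<Rightarrow> 'f" where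
  "coord e x l = (case l of X i \<Rightarrow> form x (e (Y i)) | Y i \<Rightarrow> form (e (X i)) x)"

lemma standard_basis_frame: "standard_basis n e \<Longrightarrow> symplectic_frame n e"
  unfolding standard_basis_def symplectic_frame_def by blast

lemma standard_basis_span: "standard_basis n e \<Longrightarrow> span (e ` letters n) = UNIV"
  unfolding standard_basis_def by blast

lemma coord_add: "coord e (x + y) l = coord e x l + coord e y l"
  by (cases l) (simp_all add: coord_def bilinear_simps)

lemma coord_scale: "coord e (scale c x) l = c * coord e x l"
  by (cases l) (simp_all add: coord_def bilinear_simps)

lemma coord_diff: "coord e (x - y) l = coord e x l - coord e y l"
  by (cases l) (simp_all add: coord_def form_diff_left form_diff_right)

lemma coord_sum: "coord e (\<Sum>i\<in>A. g i) l = (\<Sum>i\<in>A. coord e (g i) l)"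
  by (cases l) (simp_all add: coord_def form_sum_left form_sum_right)

lemma coord_frame:
  assumes "symplectic_frame n e" "l \<in> letters n" "m \<in> letters n"
  shows "coord e (e l) m = (if l = m then 1 else 0)"
proof -
  have "form (e (X i)) (e (X j)) = 0" "form (e (Y i)) (e (Y j)) = 0"
    "form (e (X i)) (e (Y j)) = (if i = j then 1 else 0)"
    if "i \<in> {1..n}" "j \<in> {1..n}" for i j
    using assms(1) that unfolding symplectic_frame_def by blast+
  then show ?thesis
    using assms(2,3) unfolding letters_def by (auto simp: coord_def simp del: atLeastAtMost_iff One_nat_def)
      (simp_all split: if_split_asm)
qed

lemma coord_combination:
  assumes "symplectic_frame n e" "m \<in> letters n"
  shows "coord e (\<Sum>l\<in>letters n. scale (c l) (e l)) m = c m"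
proof -
  have "coord e (\<Sum>l\<in>letters n. scale (c l) (e l)) m
      = (\<Sum>l\<in>letters n. if l = m then c l else 0)"
    unfolding coord_sum coord_scale by (intro sum.cong) (auto simp: coord_frame[OF assms(1)] assms(2))
  then show ?thesis using assms(2) by simp
qed

text \<open>Coordinates detect every coefficient of a combination, so the frame is independent; if
  it did not span, a further independent vector would exceed the dimension.\<close>

lemma standard_basisI:
  assumes fr: "symplectic_frame n e" and dim: "dim (UNIV :: 'v set) = 2 * n"
  shows "standard_basis n e"
proof -
  have inj: "inj_on e (letters n)"
  proof (rule inj_onI)
    fix l m assume "l \<in> letters n" "m \<in> letters n" "e l = e m"
    then show "l = m"
      using coord_frame[OF fr, of l m] coord_frame[OF fr, of m m] by (auto split: if_splits)
  qed
  have ind: "independent (e ` letters n)"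
  proof (rule independent_if_scalars_zero)
    fix f x assume 0: "(\<Sum>x\<in>e ` letters n. scale (f x) x) = 0" and "x \<in> e ` letters n"
    then obtain m where m: "m \<in> letters n" "x = e m" by blast
    have "(\<Sum>l\<in>letters n. scale (f (e l)) (e l)) = 0"
      using 0 by (simp add: sum.reindex[OF inj])
    then have "f (e m) = coord e 0 m"
      using coord_combination[OF fr m(1), of "\<lambda>l. f (e l)"] by simp
    then show "f x = 0"
      using m(2) coord_scale[of e 0 0 m] by simp
  qed simp
  have "span (e ` letters n) = UNIV"
  proof (rule ccontr)
    assume "span (e ` letters n) \<noteq> UNIV"
    then obtain x where x: "x \<notin> span (e ` letters n)" by blast
    have ind': "independent (insert x (e ` letters n))"
      using x ind by (rule independent_insertI)
    obtain C where C: "C \<subseteq> UNIV" "independent C" "(UNIV :: 'v set) \<subseteq> span C" "card C = dim (UNIV :: 'v set)"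
      by (rule basis_exists)
    have "card (insert x (e ` letters n)) \<le> card C"
      using independent_span_bound[OF finite_independent[OF C(2)] ind'] C(3) by blast
    moreover have "x \<notin> e ` letters n" using x span_base by blast
    ultimately show False
      using C(4) dim inj by (simp add: card_image card_letters)
  qed
  with inj ind fr show ?thesis
    unfolding standard_basis_def symplectic_frame_def by blast
qed

lemma dim_standard_basis:
  assumes "standard_basis n e"
  shows "dim (UNIV :: 'v set) = 2 * n"
proof -
  have "dim (span (e ` letters n)) = card (e ` letters n)"
    by (rule dim_span_eq_card_independent) (use assms in \<open>simp add: standard_basis_def\<close>)
  then have "dim (UNIV :: 'v set) = card (e ` letters n)"
    unfolding standard_basis_span[OF assms] .
  also have "\<dots> = 2 * n"
    using assms by (simp add: standard_basis_def card_image card_letters)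
  finally show ?thesis .
qed

lemma functional_eq_0_on_basis:
  fixes g :: "'v \<Rightarrow> 'f"
  assumes "standard_basis n e" "\<And>l. l \<in> letters n \<Longrightarrow> g (e l) = 0"
    and "\<And>x y. g (x + y) = g x + g y" "\<And>c x. g (scale c x) = c * g x"
  shows "g x = 0"
proof -
  have "x \<in> span (e ` letters n)"
    using standard_basis_span[OF assms(1)] by simp
  then show ?thesis
  proof (induction rule: span_induct_alt)
    case base
    then show ?case using assms(4)[of 0 0] by simp
  next
    case (step c x y)
    then show ?case using assms by auto
  qed
qed

text \<open>Up to sign, the coordinates of \<open>x\<close> are its pairings with all basis vectors,
  so nondegeneracy applies.\<close>

lemma coord_eq_0:
  assumes "standard_basis n e" "\<And>l. l \<in> letters n \<Longrightarrow> coord e x l = 0"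
  shows "x = 0"
proof (rule form_nondegenerate)
  fix y
  have "form x (e l) = 0" if "l \<in> letters n" for l
  proof (cases l)
    case (X i)
    then have "Y i \<in> letters n" using that by (auto simp: letters_def)
    then show ?thesis
      using assms(2)[of "Y i"] form_antisym[of x "e (X i)"] X by (simp add: coord_def)
  next
    case (Y i)
    then have "X i \<in> letters n" using that by (auto simp: letters_def)
    then show ?thesis
      using assms(2)[of "X i"] Y by (simp add: coord_def)
  qed
  then show "form x y = 0"
    by (rule functional_eq_0_on_basis[OF assms(1)]) (simp_all add: bilinear_simps)
qed

lemma coord_expansion:
  assumes "standard_basis n e"
  shows "x = (\<Sum>l\<in>letters n. scale (coord e x l) (e l))"
proof -
  have "x - (\<Sum>l\<in>letters n. scale (coord e x l) (e l)) = 0"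
    by (rule coord_eq_0[OF assms])
      (simp add: coord_diff coord_combination[OF standard_basis_frame[OF assms]])
  then show ?thesis by simp
qed

section \<open>The trilinear form in coordinates versus the listed presentation\<close>

definition presented_by :: "(letter \<Rightarrow> 'v) \<Rightarrow> bool" where
  "presented_by e \<longleftrightarrow> standard_basis 5 e \<and>
     (\<forall>x y z. tri x y z = shape (coord e x) (coord e y) (coord e z))"

text \<open>Both sides are trilinear, so their difference \<open>D\<close> is tested on the basis
  one argument at a time.\<close>

lemma presented_by_basisI:
  assumes sb: "standard_basis 5 e"
    and eq: "\<And>u v w. u \<in> letters 5 \<Longrightarrow> v \<in> letters 5 \<Longrightarrow> w \<in> letters 5 \<Longrightarrow>
      tri (e u) (e v) (e w) = shape (coord e (e u)) (coord e (e v)) (coord e (e w))"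
  shows "presented_by e"
proof -
  define D where "D x y z = tri x y z - shape (coord e x) (coord e y) (coord e z)" for x y z
  have add: "D (x + x') y z = D x y z + D x' y z" "D x (y + y') z = D x y z + D x y' z"
    "D x y (z + z') = D x y z + D x y z'" for x x' y y' z z'
    by (simp_all add: D_def tri_linear shape_def det3_def coord_add algebra_simps)
  have scl: "D (scale c x) y z = c * D x y z" "D x (scale c y) z = c * D x y z"
    "D x y (scale c z) = c * D x y z" for c x y z
    by (simp_all add: D_def tri_linear shape_def det3_def coord_scale algebra_simps)
  have "D (e u) (e v) (e w) = 0" if "u \<in> letters 5" "v \<in> letters 5" "w \<in> letters 5" for u v w
    using eq[OF that] by (simp add: D_def)
  then have "D (e u) (e v) z = 0" if "u \<in> letters 5" "v \<in> letters 5" for u v z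
    by (rule functional_eq_0_on_basis[OF sb]) (simp_all add: that add scl)
  then have "D (e u) y z = 0" if "u \<in> letters 5" for u y z
    by (rule functional_eq_0_on_basis[OF sb]) (simp_all add: that add scl)
  then have "D x y z = 0" for x y z
    by (rule functional_eq_0_on_basis[OF sb]) (simp_all add: add scl)
  then show ?thesis
    using sb by (simp add: presented_by_def D_def)
qed

text \<open>Both sides change by the same sign under permutations and agree at \<open>a\<close>,
  \<open>b\<close>, \<open>c\<close>.\<close>

lemma det3_eq_tri:
  assumes fr: "symplectic_frame 5 e" and abc: "a \<in> letters 5" "b \<in> letters 5" "c \<in> letters 5"
    "distinct [a, b, c]" and one: "tri (e a) (e b) (e c) = 1" and set: "{u, v, w} = {a, b, c}"
  shows "det3 a b c (coord e (e u)) (coord e (e v)) (coord e (e w)) = tri (e u) (e v) (e w)"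
proof -
  have "det3 a b c (coord e (e a)) (coord e (e b)) (coord e (e c)) = 1"
    "det3 a b c (coord e (e b)) (coord e (e c)) (coord e (e a)) = 1"
    "det3 a b c (coord e (e c)) (coord e (e a)) (coord e (e b)) = 1"
    "det3 a b c (coord e (e b)) (coord e (e a)) (coord e (e c)) = -1"
    "det3 a b c (coord e (e c)) (coord e (e b)) (coord e (e a)) = -1"
    "det3 a b c (coord e (e a)) (coord e (e c)) (coord e (e b)) = -1"
    using abc by (simp_all add: det3_def coord_frame[OF fr])
  moreover have "tri (e b) (e c) (e a) = 1" "tri (e c) (e a) (e b) = 1"
    "tri (e b) (e a) (e c) = -1" "tri (e c) (e b) (e a) = -1" "tri (e a) (e c) (e b) = -1"
    using one by (simp_all add: tri_perms[where x = "e a" and y = "e b" and z = "e c"])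
  ultimately show ?thesis
    using set_eq_perm3[OF set abc(4)] one by auto
qed

lemma det3_basis_eq_0:
  assumes fr: "symplectic_frame 5 e" and abc: "a \<in> letters 5" "b \<in> letters 5" "c \<in> letters 5"
    "distinct [a, b, c]" and uvw: "u \<in> letters 5" "v \<in> letters 5" "w \<in> letters 5"
    and set: "{u, v, w} \<noteq> {a, b, c}"
  shows "det3 a b c (coord e (e u)) (coord e (e v)) (coord e (e w)) = 0"
proof -
  have "l \<in> letters 5" if "l \<in> {a, b, c}" for l
    using that abc(1-3) by blast
  then show ?thesis
    by (intro det3_kronecker[OF _ _ _ abc(4) set] coord_frame[OF fr] uvw)
qed

text \<open>This makes the minors of the other two listed triples vanish on every rearrangement of
  the third.\<close>

lemma letter_sets_distinct:
  "{Y 2, Y 3, Y 4} \<noteq> {Y 1, Y 4, Y 5}" "{Y 2, Y 3, Y 4} \<noteq> {X 1, Y 3, Y 5}"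
  "{Y 1, Y 4, Y 5} \<noteq> {X 1, Y 3, Y 5}"
proof -
  have "Y 2 \<notin> {Y 1, Y 4, Y 5}" "Y 2 \<notin> {X 1, Y 3, Y 5}" "Y 1 \<notin> {X 1, Y 3, Y 5}" by simp_all
  then show "{Y 2, Y 3, Y 4} \<noteq> {Y 1, Y 4, Y 5}" "{Y 2, Y 3, Y 4} \<noteq> {X 1, Y 3, Y 5}"
    "{Y 1, Y 4, Y 5} \<noteq> {X 1, Y 3, Y 5}" by blast+
qed

text \<open>Bridge between the closed formula, which can be evaluated at arbitrary vectors, and the
  values on basis letters, where the zero convention is expressed by unordered letter sets. On each
  triple of letters at most one of the three minors is nonzero.\<close>

lemma presented_by_iff:
  "presented_by e \<longleftrightarrow> standard_basis 5 e \<and>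
     tri (e (Y 2)) (e (Y 3)) (e (Y 4)) = 1 \<and> tri (e (Y 1)) (e (Y 4)) (e (Y 5)) = 1 \<and>
     tri (e (X 1)) (e (Y 3)) (e (Y 5)) = 1 \<and>
     (\<forall>u\<in>letters 5. \<forall>v\<in>letters 5. \<forall>w\<in>letters 5.
        {u, v, w} \<notin> {{Y 2, Y 3, Y 4}, {Y 1, Y 4, Y 5}, {X 1, Y 3, Y 5}} \<longrightarrow>
        tri (e u) (e v) (e w) = 0)" (is "_ \<longleftrightarrow> ?R")
proof
  assume p: "presented_by e"
  then have sb: "standard_basis 5 e" and T: "\<And>x y z. tri x y z = shape (coord e x) (coord e y) (coord e z)"
    by (auto simp: presented_by_def)
  note fr = standard_basis_frame[OF sb]
  note [simp] = coord_frame[OF fr]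
  have L: "X 1 \<in> letters 5" "Y 1 \<in> letters 5" "Y 2 \<in> letters 5" "Y 3 \<in> letters 5"
    "Y 4 \<in> letters 5" "Y 5 \<in> letters 5"
    by (auto simp: letters_5)
  have "tri (e u) (e v) (e w) = 0" if "u \<in> letters 5" "v \<in> letters 5" "w \<in> letters 5"
    "{u, v, w} \<notin> {{Y 2, Y 3, Y 4}, {Y 1, Y 4, Y 5}, {X 1, Y 3, Y 5}}" for u v w
    unfolding T shape_def using that L by (subst det3_basis_eq_0[OF fr]; simp)+
  with sb L show ?R
    by (auto simp: T shape_def det3_def simp del: One_nat_def)
next
  assume R: ?R
  then have sb: "standard_basis 5 e" by blast
  note fr = standard_basis_frame[OF sb]
  have L: "X 1 \<in> letters 5" "Y 1 \<in> letters 5" "Y 2 \<in> letters 5" "Y 3 \<in> letters 5"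
    "Y 4 \<in> letters 5" "Y 5 \<in> letters 5"
    by (auto simp: letters_5)
  note zero = det3_basis_eq_0[OF fr] and val = det3_eq_tri[OF fr]
  show "presented_by e"
  proof (rule presented_by_basisI[OF sb])
    fix u v w assume uvw: "u \<in> letters 5" "v \<in> letters 5" "w \<in> letters 5"
    consider "{u, v, w} = {Y 2, Y 3, Y 4}" | "{u, v, w} = {Y 1, Y 4, Y 5}"
      | "{u, v, w} = {X 1, Y 3, Y 5}"
      | "{u, v, w} \<notin> {{Y 2, Y 3, Y 4}, {Y 1, Y 4, Y 5}, {X 1, Y 3, Y 5}}"
      unfolding insert_iff empty_iff by metis
    then show "tri (e u) (e v) (e w) = shape (coord e (e u)) (coord e (e v)) (coord e (e w))"
    proof cases
      case 1
      have "det3 (Y 2) (Y 3) (Y 4) (coord e (e u)) (coord e (e v)) (coord e (e w)) = tri (e u) (e v) (e w)"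
        by (rule val) (use L R 1 in simp_all)
      moreover have "det3 (Y 1) (Y 4) (Y 5) (coord e (e u)) (coord e (e v)) (coord e (e w)) = 0"
        by (rule zero) (use L uvw 1 letter_sets_distinct in simp_all)
      moreover have "det3 (X 1) (Y 3) (Y 5) (coord e (e u)) (coord e (e v)) (coord e (e w)) = 0"
        by (rule zero) (use L uvw 1 letter_sets_distinct in simp_all)
      ultimately show ?thesis by (simp add: shape_def)
    next
      case 2
      have "det3 (Y 1) (Y 4) (Y 5) (coord e (e u)) (coord e (e v)) (coord e (e w)) = tri (e u) (e v) (e w)"
        by (rule val) (use L R 2 in simp_all)
      moreover have "det3 (Y 2) (Y 3) (Y 4) (coord e (e u)) (coord e (e v)) (coord e (e w)) = 0"
        by (rule zero) (use L uvw 2 letter_sets_distinct[symmetric] in simp_all)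
      moreover have "det3 (X 1) (Y 3) (Y 5) (coord e (e u)) (coord e (e v)) (coord e (e w)) = 0"
        by (rule zero) (use L uvw 2 letter_sets_distinct in simp_all)
      ultimately show ?thesis by (simp add: shape_def)
    next
      case 3
      have "det3 (X 1) (Y 3) (Y 5) (coord e (e u)) (coord e (e v)) (coord e (e w)) = tri (e u) (e v) (e w)"
        by (rule val) (use L R 3 in simp_all)
      moreover have "det3 (Y 2) (Y 3) (Y 4) (coord e (e u)) (coord e (e v)) (coord e (e w)) = 0"
        by (rule zero) (use L uvw 3 letter_sets_distinct[symmetric] in simp_all)
      moreover have "det3 (Y 1) (Y 4) (Y 5) (coord e (e u)) (coord e (e v)) (coord e (e w)) = 0"
        by (rule zero) (use L uvw 3 letter_sets_distinct[symmetric] in simp_all)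
      ultimately show ?thesis by (simp add: shape_def)
    next
      case 4
      have "tri (e u) (e v) (e w) = 0"
        using R[THEN conjunct2, THEN conjunct2, THEN conjunct2, THEN conjunct2, rule_format, OF uvw 4] .
      moreover have "det3 (Y 2) (Y 3) (Y 4) (coord e (e u)) (coord e (e v)) (coord e (e w)) = 0"
        by (rule zero) (use L uvw 4 in simp_all)
      moreover have "det3 (Y 1) (Y 4) (Y 5) (coord e (e u)) (coord e (e v)) (coord e (e w)) = 0"
        by (rule zero) (use L uvw 4 in simp_all)
      moreover have "det3 (X 1) (Y 3) (Y 5) (coord e (e u)) (coord e (e v)) (coord e (e w)) = 0"
        by (rule zero) (use L uvw 4 in simp_all)
      ultimately show ?thesis by (simp add: shape_def)
    qed
  qed
qed

lemma nilpotent_presentation_P10_4_1: "nilpotent_presentation 5 (P10_4_1 :: 'f presentation)"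
proof -
  have "nilpotent_triple 5 (Y 2, Y 3, Y 4)" "nilpotent_triple 5 (Y 1, Y 4, Y 5)"
    "nilpotent_triple 5 (X 1, Y 3, Y 5)"
    unfolding nilpotent_triple_def by force+
  then show ?thesis
    by (simp add: nilpotent_presentation_def P10_4_1_def)
qed

lemma has_nilpotent_presentation_iff:
  "has_nilpotent_presentation 5 (P10_4_1 :: 'f presentation) \<longleftrightarrow> (\<exists>e. presented_by e)"
proof -
  have "(\<nexists>u' v' w' c. ((u', v', w'), c) \<in> set (P10_4_1 :: 'f presentation) \<and> {u, v, w} = {u', v', w'})
    \<longleftrightarrow> {u, v, w} \<notin> {{Y 2, Y 3, Y 4}, {Y 1, Y 4, Y 5}, {X 1, Y 3, Y 5}}" for u v w
  proof -
    \<comment> \<open>The presentation is a variable here, so that the quantifiers over letters and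
      value collapse to one over list entries before the list is unfolded.\<close>
    have *: "(\<exists>u' v' w' c. ((u', v', w'), c) \<in> set P \<and> {u, v, w} = {u', v', w'})
      \<longleftrightarrow> (\<exists>p\<in>set P. {u, v, w} = (case fst p of (a, b, c) \<Rightarrow> {a, b, c}))" for P :: "'f presentation"
      by (simp only: Bex_def split_paired_Ex fst_conv prod.case)
    show ?thesis
      unfolding * by (simp only: P10_4_1_def list.set bex_simps fst_conv prod.case insert_iff empty_iff)
  qed
  moreover have "(\<forall>((u, v, w), c) \<in> set (P10_4_1 :: 'f presentation). tri (e u) (e v) (e w) = c) \<longleftrightarrow>
     tri (e (Y 2)) (e (Y 3)) (e (Y 4)) = 1 \<and> tri (e (Y 1)) (e (Y 4)) (e (Y 5)) = 1 \<and>
     tri (e (X 1)) (e (Y 3)) (e (Y 5)) = 1" for e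
    unfolding P10_4_1_def by simp
  ultimately show ?thesis
    unfolding has_nilpotent_presentation_def tri_def[symmetric] presented_by_iff
    using nilpotent_presentation_P10_4_1 by (simp only: simp_thms conj_assoc)
qed

section \<open>Invariants of the presented algebra\<close>

lemma lower_power_3: "lower_power 3 = span {w \<bullet>\<^sub>L x | w x. w \<in> lower_power 2}"
  by (simp add: numeral_3_eq_3 numeral_2_eq_2 subspace_product_def)

lemma mul_in_derived: "x \<bullet>\<^sub>L y \<in> lower_power 2"
  by (auto simp: numeral_2_eq_2 subspace_product_def intro!: span_base)

text \<open>If L^3 is central, then L^4 = L^3 L = 0. The definition of \<open>nilpotent\<close>
  shifts the index, so the witness is k = 3.\<close>

lemma nilpotentI:
  assumes "lower_power 3 \<subseteq> center"
  shows "nilpotent"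
proof -
  have "lower_power 4 = span {z \<bullet>\<^sub>L x | z x. z \<in> lower_power 3}"
    by (simp add: numeral_eq_Suc subspace_product_def)
  also have "\<dots> = {0}"
  proof -
    have "{z \<bullet>\<^sub>L x | z x. z \<in> lower_power 3} \<subseteq> {0}"
      using assms by (auto simp: center_def)
    then have "span {z \<bullet>\<^sub>L x | z x. z \<in> lower_power 3} \<subseteq> span {0}"
      by (rule span_mono)
    then show ?thesis
      using span_zero by auto
  qed
  finally have "lower_power (3 + 1) = {0}" by simp
  then show ?thesis
    unfolding nilpotent_def by blast
qed

lemma letters_5_mem: "X 1 \<in> letters 5" "X 2 \<in> letters 5" "X 3 \<in> letters 5" "X 4 \<in> letters 5"
  "X 5 \<in> letters 5" "Y 1 \<in> letters 5" "Y 2 \<in> letters 5" "Y 3 \<in> letters 5" "Y 4 \<in> letters 5"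
  "Y 5 \<in> letters 5"
  by (simp_all add: letters_5)

text \<open>The formula \<open>shape\<close> involves only these six coordinates, and each of them
  is the value of T at \<open>z\<close> and two suitable basis vectors.\<close>

lemma presented_by_center_iff:
  assumes "presented_by e"
  shows "z \<in> center \<longleftrightarrow> (\<forall>l\<in>{X 1, Y 1, Y 2, Y 3, Y 4, Y 5}. coord e z l = 0)"
proof -
  have sb: "standard_basis 5 e"
    and T: "\<And>x y z. tri x y z = shape (coord e x) (coord e y) (coord e z)"
    using assms by (simp_all add: presented_by_def)
  have frame: "coord e (e l) m = (if l = m then 1 else 0)" if "l \<in> letters 5" "m \<in> letters 5" for l m
    by (rule coord_frame[OF standard_basis_frame[OF sb] that])
  have "tri z (e (Y 3)) (e (Y 5)) = coord e z (X 1)" "tri z (e (Y 4)) (e (Y 5)) = coord e z (Y 1)"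
    "tri z (e (Y 3)) (e (Y 4)) = coord e z (Y 2)" "tri z (e (Y 4)) (e (Y 2)) = coord e z (Y 3)"
    "tri z (e (Y 2)) (e (Y 3)) = coord e z (Y 4)" "tri z (e (X 1)) (e (Y 3)) = coord e z (Y 5)"
    by (simp_all add: T shape_def det3_def frame letters_5_mem del: One_nat_def)
  then show ?thesis
    unfolding center_iff by (auto simp: T shape_def det3_def simp del: One_nat_def)
qed

lemma presented_by_center:
  assumes "presented_by e"
  shows "center = span (e ` X ` {2..5})" "dim center = 4" "isotropic center"
proof -
  have sb: "standard_basis 5 e" using assms by (simp add: presented_by_def)
  have frame: "coord e (e l) m = (if l = m then 1 else 0)" if "l \<in> letters 5" "m \<in> letters 5" for l m
    by (rule coord_frame[OF standard_basis_frame[OF sb] that])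
  note center_coord = presented_by_center_iff[OF assms]
  have range: "{2..5::nat} = {2, 3, 4, 5}" by auto
  have XL: "X ` {2..5} \<subseteq> letters 5" by (auto simp: letters_def)
  show center: "center = span (e ` X ` {2..5})"
  proof
    show "span (e ` X ` {2..5}) \<subseteq> center"
    proof (rule span_minimal[OF _ subspace_center])
      show "e ` X ` {2..5} \<subseteq> center"
        by (auto simp: range center_coord frame letters_5_mem simp del: One_nat_def)
    qed
    show "center \<subseteq> span (e ` X ` {2..5})"
    proof
      fix z assume "z \<in> center"
      then have z: "\<forall>l\<in>{X 1, Y 1, Y 2, Y 3, Y 4, Y 5}. coord e z l = 0"
        by (simp add: center_coord)
      have "scale (coord e z l) (e l) \<in> span (e ` X ` {2..5})" if "l \<in> letters 5" for l
      proof (cases "l \<in> X ` {2..5}")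
        case True
        then show ?thesis by (intro span_scale span_base) blast
      next
        case False
        then have "coord e z l = 0"
          using that z by (auto simp: letters_5 range)
        then show ?thesis by (simp add: span_zero)
      qed
      then have "(\<Sum>l\<in>letters 5. scale (coord e z l) (e l)) \<in> span (e ` X ` {2..5})"
        by (rule span_sum)
      then show "z \<in> span (e ` X ` {2..5})"
        using coord_expansion[OF sb, of z] by simp
    qed
  qed
  have ind: "independent (e ` X ` {2..5})"
    by (rule independent_mono[of "e ` letters 5"])
      (use sb XL in \<open>auto simp: standard_basis_def\<close>)
  have "card (e ` X ` {2..5}) = card (X ` {2..5})"
    by (rule card_image, rule inj_on_subset[OF _ XL]) (use sb in \<open>simp add: standard_basis_def\<close>)
  also have "\<dots> = 4" by (simp add: card_image inj_on_def)
  finally show "dim center = 4"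
    unfolding center dim_span_eq_card_independent[OF ind] .
  show "isotropic center"
    unfolding isotropic_def
  proof (intro ballI)
    fix u v assume u: "u \<in> center" and v: "v \<in> center"
    show "form u v = 0"
    proof (rule form_span_eq_0[where U = "e ` X ` {2..5}"])
      fix w assume "w \<in> e ` X ` {2..5}"
      then obtain i where i: "i \<in> {2..5}" "w = e (X i)" by blast
      then have "coord e v (Y i) = 0"
        using v by (auto simp: center_coord range)
      then show "form w v = 0" using i by (simp add: coord_def)
    qed (use u center in simp)
  qed
qed

text \<open>Elements of L^2 are orthogonal to the center, so they have no coordinate at Y 2, ..., Y
  5. Each listed triple has at least two of these letters, so T vanishes when two arguments lie in
  L^2; this gives the inclusion. As Y 2 occurs only together with Y 3 and Y 4, products with a
  factor in L^2 are orthogonal to \<open>e (Y 2)\<close>, but \<open>e (X 2)\<close> is not.\<close>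

lemma presented_by_lower_power_3:
  assumes "presented_by e"
  shows "lower_power 3 \<subset> center"
proof -
  have sb: "standard_basis 5 e"
    and T: "\<And>x y z. tri x y z = shape (coord e x) (coord e y) (coord e z)"
    using assms by (simp_all add: presented_by_def)
  note fr = standard_basis_frame[OF sb]
  note center_coord = presented_by_center_iff[OF assms]
  have X_center: "e (X i) \<in> center" if "i \<in> {2, 3, 4, 5}" for i
    unfolding presented_by_center(1)[OF assms] using that by (intro span_base) auto
  have derived: "coord e w (Y 2) = 0" "coord e w (Y 3) = 0" "coord e w (Y 4) = 0" "coord e w (Y 5) = 0"
    if "w \<in> lower_power 2" for w
    using that X_center unfolding derived_eq_orth_center orth_def coord_def by auto
  have in_center: "w \<bullet>\<^sub>L x \<in> center" if "w \<in> lower_power 2" for w x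
  proof -
    have "tri (w \<bullet>\<^sub>L x) b c = 0" for b c
    proof -
      \<comment> \<open>Moving the product across gives T(wx, b, c) = - T(w, x, bc), where both w
        and bc lie in L^2.\<close>
      have "tri (w \<bullet>\<^sub>L x) b c = form (b \<bullet>\<^sub>L c) (w \<bullet>\<^sub>L x)"
        by (subst tri_cycle) (rule tri_def)
      also have "\<dots> = - tri w x (b \<bullet>\<^sub>L c)"
        unfolding tri_def by (rule form_antisym)
      also have "\<dots> = 0"
        by (simp add: T shape_def det3_def derived[OF that] derived[OF mul_in_derived])
      finally show ?thesis .
    qed
    then show ?thesis by (simp add: center_iff)
  qed
  then have sub: "lower_power 3 \<subseteq> center"
    unfolding lower_power_3 by (intro span_minimal[OF _ subspace_center]) auto
  have "form (w \<bullet>\<^sub>L x) (e (Y 2)) = 0" if "w \<in> lower_power 2" for w x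
    unfolding tri_def[symmetric] T
    by (simp add: shape_def det3_def derived[OF that] coord_frame[OF fr] letters_5_mem del: One_nat_def)
  then have "form u (e (Y 2)) = 0" if "u \<in> lower_power 3" for u
    by (intro form_span_eq_0[OF _ that[unfolded lower_power_3]]) auto
  moreover have "form (e (X 2)) (e (Y 2)) = 1"
    using fr by (simp add: symplectic_frame_def)
  ultimately have "e (X 2) \<notin> lower_power 3" by force
  with sub X_center[of 2] show ?thesis by auto
qed

lemma presented_by_imp_nilpotent_saa_10_4_1:
  assumes "presented_by e"
  shows "nilpotent_saa_10_4_1 scale form (\<bullet>\<^sub>L)"
proof -
  have "dim (UNIV :: 'v set) = 10"
    using dim_standard_basis[of 5 e] assms by (simp add: presented_by_def)
  then show ?thesis
    unfolding nilpotent_saa_10_4_1_def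
    using symplectic_alternating_algebra_axioms presented_by_lower_power_3[OF assms]
      presented_by_center(2,3)[OF assms] nilpotentI by blast
qed

end

section \<open>Isomorphism of presented algebras, and a concrete model\<close>

lemma presented_imp_isomorphic:
  assumes S: "symplectic_alternating_algebra sc form mul"
    and S': "symplectic_alternating_algebra sc' form' mul'"
    and e: "symplectic_alternating_algebra.presented_by sc form mul e"
    and e': "symplectic_alternating_algebra.presented_by sc' form' mul' e'"
  shows "saa_isomorphic sc form mul sc' form' mul'"
proof -
  interpret A: symplectic_alternating_algebra sc form mul by fact
  interpret B: symplectic_alternating_algebra sc' form' mul' by fact
  have sb: "A.standard_basis 5 e" "B.standard_basis 5 e'"
    using e e' by (simp_all add: A.presented_by_def B.presented_by_def)
  note fr = A.standard_basis_frame[OF sb(1)] B.standard_basis_frame[OF sb(2)]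
  \<comment> \<open>The two maps copy coordinates from one standard basis to the other. T is the
    same formula \<open>shape\<close> of the coordinates on both sides, hence \<open>\<phi>\<close>
    preserves it.\<close>
  define \<phi> where "\<phi> x = (\<Sum>l\<in>letters 5. sc' (A.coord e x l) (e' l))" for x
  define \<psi> where "\<psi> y = (\<Sum>l\<in>letters 5. sc (B.coord e' y l) (e l))" for y
  have coord_\<phi>: "B.coord e' (\<phi> x) l = A.coord e x l" if "l \<in> letters 5" for x l
    unfolding \<phi>_def by (rule B.coord_combination[OF fr(2) that])
  have coord_\<psi>: "A.coord e (\<psi> y) l = B.coord e' y l" if "l \<in> letters 5" for y l
    unfolding \<psi>_def by (rule A.coord_combination[OF fr(1) that])
  have \<psi>\<phi>: "\<psi> (\<phi> x) = x" for x
    unfolding \<psi>_def using A.coord_expansion[OF sb(1), of x] by (simp add: coord_\<phi>)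
  have \<phi>\<psi>: "\<phi> (\<psi> y) = y" for y
    unfolding \<phi>_def using B.coord_expansion[OF sb(2), of y] by (simp add: coord_\<psi>)
  have add: "\<phi> (x + y) = \<phi> x + \<phi> y" for x y
    by (simp add: \<phi>_def A.coord_add B.scale_left_distrib sum.distrib)
  have scl: "\<phi> (sc c x) = sc' c (\<phi> x)" for c x
    by (simp add: \<phi>_def A.coord_scale B.scale_sum_right)
  have lin: "Vector_Spaces.linear sc sc' \<phi>"
    using A.vector_space_axioms B.vector_space_axioms by (simp add: Vector_Spaces.linear_iff add scl)
  have bij: "bij \<phi>"
    by (rule bij_betw_byWitness[where f' = \<psi>]) (auto simp: \<psi>\<phi> \<phi>\<psi>)
  have \<phi>_basis: "\<phi> (e l) = e' l" if "l \<in> letters 5" for l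
  proof -
    have "(\<Sum>m\<in>letters 5. sc' (A.coord e (e l) m) (e' m)) = (\<Sum>m\<in>letters 5. if m = l then e' m else 0)"
      by (rule sum.cong) (auto simp: A.coord_frame[OF fr(1) that])
    then show ?thesis using that by (simp add: \<phi>_def)
  qed
  have form_basis: "form' (e' l) (e' m) = form (e l) (e m)" if "l \<in> letters 5" "m \<in> letters 5" for l m
  proof (cases m)
    case (X i)
    then have "Y i \<in> letters 5" using that by (auto simp: letters_def)
    then show ?thesis
      using A.coord_frame[OF fr(1) that(1), of "Y i"] B.coord_frame[OF fr(2) that(1), of "Y i"] X
        A.form_antisym[of "e l" "e m"] B.form_antisym[of "e' l" "e' m"]
      by (simp add: A.coord_def B.coord_def)
  next
    case (Y i)
    then have "X i \<in> letters 5" using that by (auto simp: letters_def)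
    then show ?thesis
      using A.coord_frame[OF fr(1) that(1), of "X i"] B.coord_frame[OF fr(2) that(1), of "X i"] Y
      by (simp add: A.coord_def B.coord_def)
  qed
  have "form' (\<phi> (e l)) (\<phi> y) - form (e l) y = 0" if "l \<in> letters 5" for l y
    by (rule A.functional_eq_0_on_basis[OF sb(1)])
      (simp_all add: that add scl A.bilinear_simps B.bilinear_simps \<phi>_basis form_basis algebra_simps)
  then have "form' (\<phi> x) (\<phi> y) - form x y = 0" for x y
    by (rule A.functional_eq_0_on_basis[OF sb(1)])
      (simp_all add: add scl A.bilinear_simps B.bilinear_simps algebra_simps)
  then have form: "form' (\<phi> x) (\<phi> y) = form x y" for x y by simp
  have tri: "B.tri (\<phi> x) (\<phi> y) (\<phi> z) = A.tri x y z" for x y z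
  proof -
    have "B.tri (\<phi> x) (\<phi> y) (\<phi> z) = shape (B.coord e' (\<phi> x)) (B.coord e' (\<phi> y)) (B.coord e' (\<phi> z))"
      using e' by (simp add: B.presented_by_def)
    also have "\<dots> = shape (A.coord e x) (A.coord e y) (A.coord e z)"
      by (simp add: shape_def det3_def coord_\<phi> letters_5 del: One_nat_def)
    also have "\<dots> = A.tri x y z"
      using e by (simp add: A.presented_by_def)
    finally show ?thesis .
  qed
  have mul: "\<phi> (mul x y) = mul' (\<phi> x) (\<phi> y)" for x y
  proof -
    \<comment> \<open>The product is recovered from T: the difference of the two sides is tested
      against every \<open>w\<close>, written as \<open>\<phi> (\<psi> w)\<close> so that the
      preservation of T and of the form applies.\<close>
    have "form' (\<phi> (mul x y) - mul' (\<phi> x) (\<phi> y)) w = 0" for w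
    proof -
      have "form' (\<phi> (mul x y)) (\<phi> (\<psi> w)) = form' (mul' (\<phi> x) (\<phi> y)) (\<phi> (\<psi> w))"
        using tri[of x y "\<psi> w"] unfolding form A.tri_def B.tri_def by simp
      then show ?thesis
        by (simp add: \<phi>\<psi> B.form_diff_left)
    qed
    then have "\<phi> (mul x y) - mul' (\<phi> x) (\<phi> y) = 0"
      by (rule B.form_nondegenerate)
    then show ?thesis by simp
  qed
  show ?thesis
    unfolding saa_isomorphic_def using lin bij mul form by blast
qed

text \<open>Instead of a multiplication table, the product is defined as the vector representing the
  functional \<open>shape\<close> at x and y through the form; most axioms then become polynomial
  identities in the coordinates.\<close>

lemma ex_presented_algebra:
  "\<exists>(form :: 'f::field ^ 10 \<Rightarrow> 'f ^ 10 \<Rightarrow> 'f) mul.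
     symplectic_alternating_algebra (*s) form mul \<and>
     (\<exists>e. symplectic_alternating_algebra.presented_by (*s) form mul e)"
proof -
  have "card (letters 5) = card (UNIV :: 10 set)"
    by (simp add: card_letters)
  \<comment> \<open>Any bijection between the ten letters and the index type will do.\<close>
  then obtain idx :: "letter \<Rightarrow> 10" where idx: "bij_betw idx (letters 5) UNIV"
    using finite_same_card_bij[of "letters 5" "UNIV :: 10 set"] by auto
  have range: "{1..5::nat} = {1,2,3,4,5}" by auto
  define crd :: "'f ^ 10 \<Rightarrow> letter \<Rightarrow> 'f" where "crd x l = x $ idx l" for x l
  define ofcrd :: "(letter \<Rightarrow> 'f) \<Rightarrow> 'f ^ 10" where
    "ofcrd g = (\<chi> k. g (inv_into (letters 5) idx k))" for g
  have crd_ofcrd: "crd (ofcrd g) l = g l" if "l \<in> letters 5" for g l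
    using idx that by (simp add: crd_def ofcrd_def bij_betw_def)
  have crd_inject: "x = y" if "\<And>l. l \<in> letters 5 \<Longrightarrow> crd x l = crd y l" for x y
  proof -
    have "x $ k = y $ k" for k
    proof -
      have "k \<in> idx ` letters 5" using idx by (simp add: bij_betw_def)
      then show ?thesis using that by (auto simp: crd_def)
    qed
    then show ?thesis by (simp add: vec_eq_iff)
  qed
  have crd_add: "crd (x + y) l = crd x l + crd y l" and crd_scale: "crd (c *s x) l = c * crd x l"
    and crd_zero: "crd 0 l = 0"
    for x y c l
    by (simp_all add: crd_def)
  define form :: "'f ^ 10 \<Rightarrow> 'f ^ 10 \<Rightarrow> 'f" where
    "form x y = (\<Sum>i\<in>{1,2,3,4,5}. crd x (X i) * crd y (Y i) - crd x (Y i) * crd y (X i))" for x y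
  define \<delta> :: "letter \<Rightarrow> letter \<Rightarrow> 'f" where "\<delta> l m = (if l = m then 1 else 0)" for l m
  \<comment> \<open>Chosen to make (xy, z) equal to \<open>shape\<close> at x, y, z: an X-coordinate
    is the pairing with the Y partner, and the sign in the Y case comes from (y_i, x_i) =
    -1.\<close>
  define mul :: "'f ^ 10 \<Rightarrow> 'f ^ 10 \<Rightarrow> 'f ^ 10" where
    "mul x y = ofcrd (\<lambda>l. case l of X i \<Rightarrow> shape (crd x) (crd y) (\<delta> (Y i))
                               | Y i \<Rightarrow> - shape (crd x) (crd y) (\<delta> (X i)))" for x y
  have crd_mul: "crd (mul x y) (X i) = shape (crd x) (crd y) (\<delta> (Y i))"
    "crd (mul x y) (Y i) = - shape (crd x) (crd y) (\<delta> (X i))" if "i \<in> {1,2,3,4,5}" for x y i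
    unfolding mul_def using that by (simp_all add: crd_ofcrd letters_5 del: One_nat_def)
  have form_mul: "form (mul x y) z = shape (crd x) (crd y) (crd z)" for x y z
    by (simp add: form_def crd_mul shape_def det3_def \<delta>_def del: One_nat_def)
      (simp add: algebra_simps)
  have vs: "vector_space ((*) :: 'f \<Rightarrow> 'f \<Rightarrow> 'f)"
    by unfold_locales (simp_all add: algebra_simps)
  have form_\<delta>: "form x (ofcrd (\<delta> (Y i))) = crd x (X i)" "form x (ofcrd (\<delta> (X i))) = - crd x (Y i)"
    if "i \<in> {1,2,3,4,5}" for x i
    using that by (auto simp: form_def crd_ofcrd letters_5 \<delta>_def simp del: One_nat_def)
  have saa: "symplectic_alternating_algebra (*s) form mul"
  proof (rule symplectic_alternating_algebra.intro[OF vec.vector_space_axioms],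
      rule symplectic_alternating_algebra_axioms.intro)
    show "\<exists>B. finite B \<and> vec.span B = (UNIV :: ('f ^ 10) set)"
      using finite_cart_basis span_cart_basis by blast
    show "Vector_Spaces.linear (*s) (*) (\<lambda>x. form x y)" "Vector_Spaces.linear (*s) (*) (form y)" for y
      using vs vec.vector_space_axioms
      by (auto simp: Vector_Spaces.linear_iff form_def crd_add crd_scale algebra_simps)
    show "Vector_Spaces.linear (*s) (*s) (\<lambda>x. mul x y)" for y
      using vec.vector_space_axioms
      by (auto simp: Vector_Spaces.linear_iff crd_mul crd_add crd_scale letters_5 shape_def det3_def
          algebra_simps simp del: One_nat_def intro!: crd_inject)
    show "Vector_Spaces.linear (*s) (*s) (mul x)" for x
      using vec.vector_space_axioms
      by (auto simp: Vector_Spaces.linear_iff crd_mul crd_add crd_scale letters_5 shape_def det3_def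
          algebra_simps simp del: One_nat_def intro!: crd_inject)
    show "form x x = 0" for x by (simp add: form_def mult.commute)
    show "x = 0" if "\<And>y. form x y = 0" for x
    proof (rule crd_inject)
      fix l assume "l \<in> letters 5"
      then consider i where "i \<in> {1,2,3,4,5}" "l = X i" | i where "i \<in> {1,2,3,4,5}" "l = Y i"
        unfolding letters_def range by (elim UnE imageE)
      then have "crd x l = 0"
      proof cases
        case 1
        then show ?thesis using form_\<delta>(1)[OF 1(1), of x] that by simp
      next
        case 2
        then show ?thesis using form_\<delta>(2)[OF 2(1), of x] that by simp
      qed
      then show "crd x l = crd 0 l" by (simp add: crd_def)
    qed
    show "mul x x = 0" for x
      by (rule crd_inject)
        (auto simp: letters_5 crd_mul shape_def det3_def crd_zero algebra_simps simp del: One_nat_def)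
    show "form (mul x y) z = form (mul y z) x" for x y z
      unfolding form_mul by (simp add: shape_def det3_def algebra_simps)
  qed
  interpret symplectic_alternating_algebra "(*s)" form mul by (rule saa)
  define e where "e l = ofcrd (\<delta> l)" for l
  have fr: "symplectic_frame 5 e"
  proof -
    have L: "X i \<in> letters 5" "Y i \<in> letters 5" if "i \<in> {1,2,3,4,5}" for i
      using that unfolding letters_5 by blast+
    show ?thesis
      unfolding symplectic_frame_def range
    proof (intro ballI)
      fix i j :: nat assume i: "i \<in> {1,2,3,4,5}" and j: "j \<in> {1,2,3,4,5}"
      show "form (e (X i)) (e (X j)) = 0 \<and> form (e (Y i)) (e (Y j)) = 0 \<and>
          form (e (X i)) (e (Y j)) = (if i = j then 1 else 0)"
        unfolding e_def form_\<delta>[OF j] crd_ofcrd[OF L(1)[OF j]] crd_ofcrd[OF L(2)[OF j]]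
        by (simp add: \<delta>_def)
    qed
  qed
  have sb: "standard_basis 5 e"
    by (rule standard_basisI[OF fr]) (simp add: card_cart_basis)
  have coord: "coord e x l = crd x l" if l: "l \<in> letters 5" for x l
  proof -
    consider i where "i \<in> {1,2,3,4,5}" "l = X i" | i where "i \<in> {1,2,3,4,5}" "l = Y i"
      using l unfolding letters_def range by (elim UnE imageE)
    then show ?thesis
    proof cases
      case 1
      then show ?thesis by (simp add: coord_def e_def form_\<delta> del: One_nat_def)
    next
      case 2
      then show ?thesis
        using form_antisym[of "e (X i)" x]
        by (simp add: coord_def e_def form_\<delta> del: One_nat_def)
    qed
  qed
  have "presented_by e"
    unfolding presented_by_def tri_def form_mul
    using sb by (simp add: shape_def det3_def coord letters_5_mem del: One_nat_def)
  with saa show ?thesis by blast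
qed

section \<open>Adapted bases relative to the center\<close>

context symplectic_alternating_algebra
begin

text \<open>Independence modulo the complement of \<open>Z\<close> makes the \<open>f i\<close>
  independent functionals on \<open>Z\<close>, so they have dual partners inside \<open>Z\<close>.
  Since \<open>Z\<close> is isotropic and orthogonal to \<open>u\<close> and \<open>v\<close>,
  adding its elements changes neither (u, v) nor pairings with \<open>Z\<close>, and the partners
  allow all remaining pairings to be corrected.\<close>

lemma symplectic_frame_completion:
  fixes f :: "nat \<Rightarrow> 'v"
  assumes Z: "subspace Z" "isotropic Z"
    and uv: "u \<in> orth Z" "v \<in> orth Z" "form u v = 1"
    and indep: "\<And>c i. (\<Sum>i\<in>{2..5}. scale (c i) (f i)) \<in> orth Z \<Longrightarrow> i \<in> {2..5} \<Longrightarrow> c i = 0"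
  shows "\<exists>e. symplectic_frame 5 e \<and> e (X 1) - u \<in> Z \<and> e (Y 1) - v \<in> Z \<and>
    (\<forall>i\<in>{2..5}. e (X i) \<in> Z \<and> e (Y i) - f i \<in> Z)"
proof -
  have "\<exists>s. (\<forall>j\<in>{2..5}. s j \<in> Z) \<and>
      (\<forall>i\<in>{2..5}. \<forall>j\<in>{2..5}. form (f i) (s j) = (if i = j then 1 else 0))"
  proof (rule dual_vectors[of "{2..5}" Z f])
    fix c :: "nat \<Rightarrow> 'f" and i :: nat
    assume 0: "\<And>s. s \<in> Z \<Longrightarrow> form (\<Sum>i\<in>{2..5}. scale (c i) (f i)) s = 0" and i: "i \<in> {2..5}"
    have "form s (\<Sum>i\<in>{2..5}. scale (c i) (f i)) = 0" if "s \<in> Z" for s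
      using 0[OF that] by (subst form_antisym) simp
    then show "c i = 0"
      by (intro indep[OF _ i]) (simp add: orth_def)
  qed (use Z in blast)+
  then obtain s where s: "\<And>j. j \<in> {2..5} \<Longrightarrow> s j \<in> Z"
    "\<And>i j. i \<in> {2..5} \<Longrightarrow> j \<in> {2..5} \<Longrightarrow> form (f i) (s j) = (if i = j then 1 else 0)"
    by blast
  \<comment> \<open>The partners satisfy (f_j, s_j) = 1, whereas a standard basis requires (x_j,
    y_j) = 1.\<close>
  define x where "x j = - s j" for j
  have xZ: "x j \<in> Z" if "j \<in> {2..5}" for j
    unfolding x_def using Z(1) s(1)[OF that] by (rule subspace_neg)
  have xf: "form (x j) (f i) = (if i = j then 1 else 0)" if "i \<in> {2..5}" "j \<in> {2..5}" for i j
    using s(2)[OF that] form_antisym[of "s j" "f i"] unfolding x_def by (simp add: form_minus)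
  define cz where "cz \<beta> = (\<Sum>i\<in>{2..5}. scale (\<beta> i) (x i))" for \<beta> :: "nat \<Rightarrow> 'f"
  have czZ: "cz \<beta> \<in> Z" for \<beta>
    unfolding cz_def using Z(1) xZ by (intro subspace_sum subspace_scale) auto
  have czf: "form (cz \<beta>) (f j) = \<beta> j" if "j \<in> {2..5}" for \<beta> j
  proof -
    have "form (cz \<beta>) (f j) = (\<Sum>i\<in>{2..5}. if i = j then \<beta> i else 0)"
      unfolding cz_def form_sum_left form_scale_left using that by (intro sum.cong) (auto simp: xf)
    then show ?thesis using that by simp
  qed
  have fcz: "form (f j) (cz \<beta>) = - \<beta> j" if "j \<in> {2..5}" for \<beta> j
    by (subst form_antisym) (simp add: czf[OF that])
  have ZZ: "form a b = 0" if "a \<in> Z" "b \<in> Z" for a b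
    using Z(2) that unfolding isotropic_def by blast
  have Zuv: "form a u = 0" "form a v = 0" "form u a = 0" "form v a = 0" if "a \<in> Z" for a
    using uv(1,2) that form_antisym[of u a] form_antisym[of v a] unfolding orth_def by auto
  \<comment> \<open>The corrections cancel the pairings of \<open>u\<close> and \<open>v\<close>
    with the \<open>f j\<close> and those among the \<open>f i\<close>. The latter are treated
    triangularly: in each pair only the vector of larger index is changed, so that its pairing is
    subtracted once.\<close>
  define e where "e l = (case l of
      X i \<Rightarrow> if i = 1 then u + cz (\<lambda>j. - form u (f j)) else x i
    | Y i \<Rightarrow> if i = 1 then v + cz (\<lambda>j. - form v (f j))
        else f i + cz (\<lambda>j. if j < i then form (f j) (f i) else 0))" for l
  have range: "{1..5::nat} = insert 1 {2..5}" by auto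
  have X1: "e (X 1) = u + cz (\<lambda>j. - form u (f j))" and Y1: "e (Y 1) = v + cz (\<lambda>j. - form v (f j))"
    by (simp_all add: e_def)
  have Xi: "e (X i) = x i"
    and Yi: "e (Y i) = f i + cz (\<lambda>j. if j < i then form (f j) (f i) else 0)"
    if "i \<in> {2..5}" for i
    using that by (simp_all add: e_def)
  have vu: "form v u = -1" using uv(3) form_antisym[of v u] by simp
  note simps = form_add_left form_add_right czf fcz ZZ czZ Zuv xZ xf form_alternating uv(3) vu
  have "symplectic_frame 5 e"
    unfolding symplectic_frame_def range
  proof (intro ballI)
    fix i j :: nat assume "i \<in> insert 1 {2..5}" "j \<in> insert 1 {2..5}"
    then consider "i = 1" "j = 1" | "i = 1" "j \<in> {2..5}" "j \<noteq> 1" | "j = 1" "i \<in> {2..5}" "i \<noteq> 1"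
      | "i \<in> {2..5}" "j \<in> {2..5}"
      by fastforce
    then show "form (e (X i)) (e (X j)) = 0 \<and> form (e (Y i)) (e (Y j)) = 0 \<and>
        form (e (X i)) (e (Y j)) = (if i = j then 1 else 0)"
    proof cases
      case 1
      show ?thesis unfolding 1 X1 Y1 by (simp add: simps)
    next
      case 2
      show ?thesis unfolding 2(1) X1 Y1 Xi[OF 2(2)] Yi[OF 2(2)]
        using 2(2,3) by (simp add: simps del: atLeastAtMost_iff)
    next
      case 3
      have "form (f i) v + form v (f i) = 0" using form_antisym[of v "f i"] by simp
      then show ?thesis unfolding 3(1) X1 Y1 Xi[OF 3(2)] Yi[OF 3(2)]
        using 3(2,3) by (simp add: simps del: atLeastAtMost_iff)
    next
      case 4
      show ?thesis unfolding Xi[OF 4(1)] Yi[OF 4(1)] Xi[OF 4(2)] Yi[OF 4(2)]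
        using 4 form_antisym[of "f i" "f j"] by (auto simp: simps simp del: atLeastAtMost_iff)
    qed
  qed
  then show ?thesis
    by (intro exI[of _ e]) (simp add: Xi Yi xZ czZ X1 Y1 del: atLeastAtMost_iff One_nat_def)
qed

text \<open>The prescribed element gets index 2 because its dual partner is to become
  \<open>e (Y 2)\<close> modulo the center.\<close>

lemma ex_bij_betw_2_5:
  assumes "card B = 4" "b \<in> B"
  obtains g :: "nat \<Rightarrow> 'a" where "bij_betw g {2..5} B" "g 2 = b"
proof -
  have "finite B" using assms(1) card.infinite by fastforce
  then have "card {3..5::nat} = card (B - {b})" using assms by simp
  then obtain h where h: "bij_betw h {3..5::nat} (B - {b})"
    using finite_same_card_bij[of "{3..5::nat}" "B - {b}"] \<open>finite B\<close> by auto
  have "bij_betw (h(2 := b)) {3..5} (B - {b})"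
    using h by (rule bij_betw_cong[THEN iffD1, rotated]) simp
  then have "bij_betw (h(2 := b)) ({3..5} \<union> {2}) (B - {b} \<union> {b})"
    by (rule bij_betw_combine) (auto simp: bij_betw_def)
  moreover have "{3..5} \<union> {2::nat} = {2..5}" by auto
  moreover have "B - {b} \<union> {b} = B" using assms(2) by blast
  ultimately show ?thesis using that[of "h(2 := b)"] by simp
qed

lemma mul_derived_in_lower_power_3: "w \<in> lower_power 2 \<Longrightarrow> w \<bullet>\<^sub>L x \<in> lower_power 3"
  unfolding lower_power_3 by (rule span_base) blast

text \<open>The vector y2 arises as a dual partner: a basis of L^3 is extended to one of the center,
  properness gives an additional element \<open>b\<close>, and the partner of \<open>b\<close> is
  orthogonal to L^3. For w in L^2 the product wx lies in L^3, so T(w, y2, x) = - (wx, y2) =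
  0.\<close>

lemma adapted_basis:
  assumes dim: "dim (UNIV :: 'v set) = 10" and iso: "isotropic center" and dimZ: "dim center = 4"
    and L3: "lower_power 3 \<subset> center"
  obtains e where "standard_basis 5 e" "\<And>i. i \<in> {2..5} \<Longrightarrow> e (X i) \<in> center"
    "e (X 1) \<in> orth center" "e (Y 1) \<in> orth center"
    "\<And>w x. w \<in> orth center \<Longrightarrow> tri w (e (Y 2)) x = 0"
proof -
  have sub3: "subspace (lower_power 3)" unfolding lower_power_3 by (rule subspace_span)
  obtain B3 where B3: "B3 \<subseteq> lower_power 3" "independent B3" "lower_power 3 \<subseteq> span B3"
    by (rule basis_exists)
  obtain B where B: "B3 \<subseteq> B" "B \<subseteq> center" "independent B" "center \<subseteq> span B"
    by (rule maximal_independent_subset_extend[of B3 center]) (use B3 L3 in auto)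
  have cardB: "card B = 4"
    using basis_card_eq_dim[OF B(2,4,3)] dimZ by simp
  have "B \<noteq> B3"
  proof
    assume "B = B3"
    then have "center \<subseteq> lower_power 3"
      using B(4) span_minimal[OF B3(1) sub3] by blast
    then show False using L3 by blast
  qed
  then obtain b where b: "b \<in> B" "b \<notin> B3" using B(1) by blast
  obtain g :: "nat \<Rightarrow> 'v" where g: "bij_betw g {2..5} B" "g 2 = b"
    by (rule ex_bij_betw_2_5[OF cardB b(1)])
  have gB: "g i \<in> B" if "i \<in> {2..5}" for i using g(1) that by (auto simp: bij_betw_def)
  have g_eq: "g i = g j \<longleftrightarrow> i = j" if "i \<in> {2..5}" "j \<in> {2..5}" for i j
    using g(1) that by (auto simp: bij_betw_def dest: inj_onD)
  obtain s where s: "\<And>b b'. b \<in> B \<Longrightarrow> b' \<in> B \<Longrightarrow> form b (s b') = (if b = b' then 1 else 0)"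
    using dual_basis[OF B(3)] by metis
  define f where "f i = s (g i)" for i
  have gf: "form (g i) (f j) = (if i = j then 1 else 0)" if "i \<in> {2..5}" "j \<in> {2..5}" for i j
    unfolding f_def using s[OF gB gB, OF that] g_eq[OF that] by simp
  have form_gf: "form (g j) (\<Sum>i\<in>{2..5}. scale (c i) (f i)) = c j" if "j \<in> {2..5}" for c j
  proof -
    have "form (g j) (\<Sum>i\<in>{2..5}. scale (c i) (f i)) = (\<Sum>i\<in>{2..5}. if i = j then c i else 0)"
      unfolding form_sum_right form_scale_right using that by (intro sum.cong) (auto simp: gf)
    then show ?thesis using that by simp
  qed
  \<comment> \<open>The subtracted combination has the same pairings with the center as
    \<open>w\<close>, so the remainder is orthogonal to it.\<close>
  have orth_proj: "w - (\<Sum>i\<in>{2..5}. scale (form (g i) w) (f i)) \<in> orth center" for w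
  proof -
    have "form x (w - (\<Sum>i\<in>{2..5}. scale (form (g i) w) (f i))) = 0" if "x \<in> center" for x
    proof (rule form_span_eq_0[of B])
      fix b assume "b \<in> B"
      then obtain j where "j \<in> {2..5}" "b = g j"
        using g(1) by (auto simp: bij_betw_def)
      then show "form b (w - (\<Sum>i\<in>{2..5}. scale (form (g i) w) (f i))) = 0"
        by (simp only: form_diff_right form_gf diff_self)
    qed (use that B(4) in blast)
    then show ?thesis by (simp add: orth_def)
  qed
  \<comment> \<open>If the complement of the center were contained in the center, the four vectors
    of \<open>B\<close> and the four \<open>f i\<close> would span L, against dimension 10.\<close>
  have "\<exists>u. u \<in> orth center \<and> u \<notin> center"
  proof (rule ccontr)
    assume "\<not> ?thesis"
    then have sub: "orth center \<subseteq> center" by blast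
    have "w \<in> span (B \<union> f ` {2..5})" for w
    proof -
      have "w - (\<Sum>i\<in>{2..5}. scale (form (g i) w) (f i)) \<in> span B"
        using orth_proj sub B(4) by blast
      then have "w - (\<Sum>i\<in>{2..5}. scale (form (g i) w) (f i)) \<in> span (B \<union> f ` {2..5})"
        using span_mono[of B "B \<union> f ` {2..5}"] by blast
      moreover have "(\<Sum>i\<in>{2..5}. scale (form (g i) w) (f i)) \<in> span (B \<union> f ` {2..5})"
        by (intro span_sum span_scale span_base) blast
      ultimately show ?thesis
        using span_add by fastforce
    qed
    then have "dim (UNIV :: 'v set) \<le> card (B \<union> f ` {2..5})"
      using finite_independent[OF B(3)] by (intro dim_le_card) auto
    also have "\<dots> \<le> card B + card (f ` {2..5})" by (rule card_Un_le)
    also have "card (f ` {2..5}) \<le> card {2..5::nat}" by (rule card_image_le) simp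
    finally show False using cardB dim by simp
  qed
  then obtain u where u: "u \<in> orth center" "u \<notin> center" by blast
  then obtain a b' where ab: "tri u a b' \<noteq> 0" by (auto simp: center_iff)
  \<comment> \<open>As \<open>u\<close> is not central it pairs nontrivially with some product;
    rescaled, this product serves as \<open>v\<close> and lies in L^2.\<close>
  define v where "v = scale (inverse (form u (a \<bullet>\<^sub>L b'))) (a \<bullet>\<^sub>L b')"
  have "form u (a \<bullet>\<^sub>L b') \<noteq> 0"
    using ab form_antisym[of u "a \<bullet>\<^sub>L b'"] tri_cycle[of u a b'] by (simp add: tri_def)
  then have uv: "form u v = 1" by (simp add: v_def form_scale_right)
  have v: "v \<in> orth center"
    unfolding v_def by (rule subspace_scale[OF subspace_orth]) (simp add: derived_eq_orth_center[symmetric] mul_in_derived)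
  obtain e where e: "symplectic_frame 5 e" "\<And>i. i \<in> {2..5} \<Longrightarrow> e (X i) \<in> center"
    "e (X 1) - u \<in> center" "e (Y 1) - v \<in> center" "\<And>i. i \<in> {2..5} \<Longrightarrow> e (Y i) - f i \<in> center"
  proof -
    have "\<exists>e. symplectic_frame 5 e \<and> e (X 1) - u \<in> center \<and> e (Y 1) - v \<in> center \<and>
        (\<forall>i\<in>{2..5}. e (X i) \<in> center \<and> e (Y i) - f i \<in> center)"
    proof (rule symplectic_frame_completion[OF subspace_center iso u(1) v uv, of f])
    fix c :: "nat \<Rightarrow> 'f" and i :: nat
    assume "(\<Sum>i\<in>{2..5}. scale (c i) (f i)) \<in> orth center" "i \<in> {2..5}"
    then show "c i = 0"
      using form_gf[of i c] gB[of i] B(2) by (auto simp: orth_def)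
    qed
    then show ?thesis using that by blast
  qed
  have center_orth: "center \<subseteq> orth center"
    using iso unfolding isotropic_def orth_def by blast
  have X1: "e (X 1) \<in> orth center"
    using subspace_add[OF subspace_orth, of "e (X 1) - u" center u] e(3) center_orth u(1) by auto
  have Y1: "e (Y 1) \<in> orth center"
    using subspace_add[OF subspace_orth, of "e (Y 1) - v" center v] e(4) center_orth v by auto
  have "form w (e (Y 2)) = 0" if w: "w \<in> lower_power 3" for w
  proof (rule form_span_eq_0[of B3])
    fix b' assume b': "b' \<in> B3"
    then obtain j where j: "j \<in> {2..5}" "b' = g j"
      using g(1) B(1) by (auto simp: bij_betw_def)
    have "form b' (f 2) = 0"
      using j b' b(2) g(2) gf[OF j(1), of 2] by auto
    moreover have "form b' (e (Y 2) - f 2) = 0"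
      using iso e(5)[of 2] b' B(1,2) unfolding isotropic_def by auto
    ultimately show "form b' (e (Y 2)) = 0" by (simp add: form_diff_right)
  qed (use w B3(3) in blast)
  then have "tri w (e (Y 2)) x = 0" if "w \<in> orth center" for w x
    using mul_derived_in_lower_power_3[of w x] that tri_swap_right[of w "e (Y 2)" x]
    unfolding derived_eq_orth_center by (simp add: tri_def)
  with standard_basisI[OF e(1)] dim e(2) X1 Y1 show ?thesis
    using that[of e] by simp
qed

section \<open>Normalising the trilinear form modulo the center\<close>

lemma tri_center:
  assumes "z \<in> center"
  shows "tri z x y = 0" "tri x z y = 0" "tri x y z = 0"
  using assms tri_swap[of z x y] tri_cycle[of z x y] by (auto simp: center_iff)

text \<open>T descends to L/Z, which is why central corrections never disturb normalised
  values.\<close>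

lemma tri_cong_center:
  assumes "x - x' \<in> center" "y - y' \<in> center" "z - z' \<in> center"
  shows "tri x y z = tri x' y' z'"
proof -
  have "tri x y z = tri x' y z" using tri_center(1)[OF assms(1)] by (simp add: tri_diff)
  also have "\<dots> = tri x' y' z" using tri_center(2)[OF assms(2)] by (simp add: tri_diff)
  also have "\<dots> = tri x' y' z'" using tri_center(3)[OF assms(3)] by (simp add: tri_diff)
  finally show ?thesis .
qed

text \<open>T(w, x, w') pairs wx, which is central, with w', which is orthogonal to the
  center.\<close>

lemma tri_derived:
  assumes "lower_power 3 \<subseteq> center" "w \<in> orth center" "w' \<in> orth center"
  shows "tri w w' x = 0"
proof -
  have "w \<bullet>\<^sub>L x \<in> center"
    using assms(1,2) mul_derived_in_lower_power_3[of w x] by (auto simp: derived_eq_orth_center)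
  then have "tri w x w' = 0" using assms(3) by (simp add: tri_def orth_def)
  then show ?thesis using tri_swap_right[of w x w'] by simp
qed

lemma letters_5_cases:
  assumes "l \<in> letters 5"
  obtains i where "i \<in> {2..5}" "l = X i" | "l = X 1" | "l = Y 1" | "l = Y 2" | "l = Y 3" | "l = Y 4" | "l = Y 5"
proof -
  have "l \<in> X ` {2..5} \<or> l = X 1 \<or> l = Y 1 \<or> l = Y 2 \<or> l = Y 3 \<or> l = Y 4 \<or> l = Y 5"
    using assms by (auto simp: letters_5)
  then show ?thesis using that by blast
qed

text \<open>With X 1, Y 1, Y 2 in the radical of T(w, -, -), only the three pairs from Y 3, Y 4, Y 5
  are left to test. The criterion serves both for combinations of u and v and for y2.\<close>

lemma center_by_basis:
  assumes sb: "standard_basis 5 e" and X: "\<And>i. i \<in> {2..5} \<Longrightarrow> e (X i) \<in> center"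
    and zero: "\<And>x. tri w (e (X 1)) x = 0" "\<And>x. tri w (e (Y 1)) x = 0" "\<And>x. tri w (e (Y 2)) x = 0"
    and "tri w (e (Y 3)) (e (Y 4)) = 0" "tri w (e (Y 3)) (e (Y 5)) = 0" "tri w (e (Y 4)) (e (Y 5)) = 0"
  shows "w \<in> center"
proof -
  have zero': "tri w x (e (X 1)) = 0" "tri w x (e (Y 1)) = 0" "tri w x (e (Y 2)) = 0" for x
    using zero tri_swap_right[of w x] by simp_all
  have swapped: "tri w (e (Y 4)) (e (Y 3)) = 0" "tri w (e (Y 5)) (e (Y 3)) = 0" "tri w (e (Y 5)) (e (Y 4)) = 0"
    using assms(6-8) tri_swap_right[of w "e (Y 4)" "e (Y 3)"] tri_swap_right[of w "e (Y 5)" "e (Y 3)"]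
      tri_swap_right[of w "e (Y 5)" "e (Y 4)"] by simp_all
  have basis: "tri w (e l) (e m) = 0" if l: "l \<in> letters 5" and m: "m \<in> letters 5" for l m
    using l
    by (cases rule: letters_5_cases; cases rule: letters_5_cases[OF m];
        simp add: tri_center X zero zero' assms(6-8) swapped del: One_nat_def)
  have l: "tri w (e l) y = 0" if "l \<in> letters 5" for l y
    by (rule functional_eq_0_on_basis[OF sb, of "tri w (e l)"]) (simp_all add: basis that tri_linear)
  have "tri w x y = 0" for x y
    by (rule functional_eq_0_on_basis[OF sb, of "\<lambda>x. tri w x y"]) (simp_all add: l tri_linear)
  then show ?thesis by (simp add: center_iff)
qed

text \<open>The vectors stand for x1, y1 and y2, ..., y5 modulo the center. The value of T at
  \<open>f 2\<close>, \<open>f 3\<close>, \<open>f 4\<close> is left open, since it is shown to be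
  nonzero only afterwards. The condition \<open>f 2 \<notin> orth center\<close> is the part of
  independence that T(u, -, -) and T(v, -, -) cannot detect.\<close>

definition reduced_vectors :: "'v \<Rightarrow> 'v \<Rightarrow> (nat \<Rightarrow> 'v) \<Rightarrow> bool" where
  "reduced_vectors u v f \<longleftrightarrow>
     u \<in> orth center \<and> v \<in> orth center \<and> form u v = 1 \<and> f 2 \<notin> orth center \<and>
     (\<forall>x. tri u (f 2) x = 0) \<and> (\<forall>x. tri v (f 2) x = 0) \<and>
     (\<forall>x. tri u (f 4) x = 0) \<and> (\<forall>x. tri v (f 3) x = 0) \<and>
     tri u (f 3) (f 5) = 1 \<and> tri v (f 4) (f 5) = 1 \<and>
     tri (f 2) (f 3) (f 5) = 0 \<and> tri (f 2) (f 4) (f 5) = 0 \<and> tri (f 3) (f 4) (f 5) = 0"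

text \<open>If a combination w of the \<open>f i\<close> is orthogonal to the center, then T(u, w,
  -) and T(v, w, -) vanish. Evaluating at \<open>f 5\<close> and \<open>f 3\<close> removes the
  coefficients of \<open>f 3\<close>, \<open>f 4\<close>, \<open>f 5\<close>, and a nonzero multiple
  of \<open>f 2\<close> is excluded by hypothesis.\<close>

lemma reduced_vectors_basis:
  assumes dim: "dim (UNIV :: 'v set) = 10" and iso: "isotropic center"
    and L3: "lower_power 3 \<subset> center" and red: "reduced_vectors u v f"
  shows "\<exists>e. standard_basis 5 e \<and> e (X 1) - u \<in> center \<and> e (Y 1) - v \<in> center \<and>
    (\<forall>i\<in>{2..5}. e (X i) \<in> center \<and> e (Y i) - f i \<in> center)"
proof -
  have L3': "lower_power 3 \<subseteq> center" using L3 by blast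
  have r: "u \<in> orth center" "v \<in> orth center" "form u v = 1" "f 2 \<notin> orth center"
    "\<And>x. tri u (f 2) x = 0" "\<And>x. tri v (f 2) x = 0" "\<And>x. tri u (f 4) x = 0" "\<And>x. tri v (f 3) x = 0"
    "tri u (f 3) (f 5) = 1" "tri v (f 4) (f 5) = 1"
    using red unfolding reduced_vectors_def by blast+
  have "tri u (f 5) (f 3) = -1" "tri v (f 5) (f 4) = -1"
    using r(9,10) tri_swap_right[of u "f 5" "f 3"] tri_swap_right[of v "f 5" "f 4"] by simp_all
  note vals = r(5-10) this
  have range: "{2..5::nat} = {2, 3, 4, 5}" by auto
  have "\<exists>e. symplectic_frame 5 e \<and> e (X 1) - u \<in> center \<and> e (Y 1) - v \<in> center \<and>
    (\<forall>i\<in>{2..5}. e (X i) \<in> center \<and> e (Y i) - f i \<in> center)"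
  proof (rule symplectic_frame_completion[OF subspace_center iso r(1-3)])
    fix c :: "nat \<Rightarrow> 'f" and i :: nat
    assume w: "(\<Sum>i\<in>{2..5}. scale (c i) (f i)) \<in> orth center" and i: "i \<in> {2..5}"
    define w where "w = (\<Sum>i\<in>{2..5}. scale (c i) (f i))"
    have w_eq: "w = scale (c 2) (f 2) + scale (c 3) (f 3) + scale (c 4) (f 4) + scale (c 5) (f 5)"
      by (simp add: w_def range add.assoc)
    have 0: "tri u w x = 0" "tri v w x = 0" for x
      using tri_derived[OF L3'] r(1,2) w by (auto simp: w_def)
    have c3: "c 3 = 0" using 0(1)[of "f 5"] unfolding w_eq by (simp add: tri_linear vals)
    have c4: "c 4 = 0" using 0(2)[of "f 5"] unfolding w_eq by (simp add: tri_linear vals)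
    have c5: "c 5 = 0" using 0(1)[of "f 3"] unfolding w_eq by (simp add: tri_linear vals)
    have c2: "c 2 = 0"
    proof (rule ccontr)
      assume "c 2 \<noteq> 0"
      then have "f 2 = scale (inverse (c 2)) w"
        by (simp add: w_eq c3 c4 c5)
      also have "\<dots> \<in> orth center"
        using w unfolding w_def by (rule subspace_scale[OF subspace_orth])
      finally show False using r(4) by blast
    qed
    show "c i = 0" using i c2 c3 c4 c5 unfolding range by auto
  qed
  then show ?thesis using standard_basisI dim by fastforce
qed

text \<open>Otherwise all of T(f 2, -, -) would vanish, so \<open>f 2\<close> would be central and,
  by isotropy, in \<open>orth center\<close>.\<close>

lemma reduced_vectors_nonzero:
  assumes dim: "dim (UNIV :: 'v set) = 10" and iso: "isotropic center"
    and L3: "lower_power 3 \<subset> center" and red: "reduced_vectors u v f"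
  shows "tri (f 2) (f 3) (f 4) \<noteq> 0"
proof
  assume 0: "tri (f 2) (f 3) (f 4) = 0"
  have r: "f 2 \<notin> orth center"
    "\<And>x. tri u (f 2) x = 0" "\<And>x. tri v (f 2) x = 0"
    "tri (f 2) (f 3) (f 5) = 0" "tri (f 2) (f 4) (f 5) = 0"
    using red unfolding reduced_vectors_def by blast+
  obtain e where e: "standard_basis 5 e" "e (X 1) - u \<in> center" "e (Y 1) - v \<in> center"
    "\<And>i. i \<in> {2..5} \<Longrightarrow> e (X i) \<in> center" "\<And>i. i \<in> {2..5} \<Longrightarrow> e (Y i) - f i \<in> center"
    using reduced_vectors_basis[OF assms] by blast
  have refl: "x - x \<in> center" for x using subspace_0[OF subspace_center] by simp
  have Y: "e (Y 2) - f 2 \<in> center" "e (Y 3) - f 3 \<in> center" "e (Y 4) - f 4 \<in> center" "e (Y 5) - f 5 \<in> center"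
    using e(5) by simp_all
  have "f 2 \<in> center"
  proof (rule center_by_basis[OF e(1,4)])
    fix x
    show "tri (f 2) (e (X 1)) x = 0"
      using tri_cong_center[OF refl e(2) refl] tri_swap[of u "f 2" x] r(2)[of x] by simp
    show "tri (f 2) (e (Y 1)) x = 0"
      using tri_cong_center[OF refl e(3) refl] tri_swap[of v "f 2" x] r(3)[of x] by simp
    show "tri (f 2) (e (Y 2)) x = 0"
      using tri_cong_center[OF refl Y(1) refl] by simp
    show "tri (f 2) (e (Y 3)) (e (Y 4)) = 0" "tri (f 2) (e (Y 3)) (e (Y 5)) = 0" "tri (f 2) (e (Y 4)) (e (Y 5)) = 0"
      using tri_cong_center[OF refl Y(2,3)] tri_cong_center[OF refl Y(2,4)] tri_cong_center[OF refl Y(3,4)]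
        0 r(4,5) by simp_all
  qed
  then show False using r(1) iso unfolding isotropic_def orth_def by blast
qed

lemma reduced_vectors_presented:
  assumes dim: "dim (UNIV :: 'v set) = 10" and iso: "isotropic center"
    and L3: "lower_power 3 \<subset> center" and red: "reduced_vectors u v f"
    and one: "tri (f 2) (f 3) (f 4) = 1"
  shows "\<exists>e. presented_by e"
proof -
  have L3': "lower_power 3 \<subseteq> center" using L3 by blast
  have r: "u \<in> orth center" "v \<in> orth center"
    "\<And>x. tri u (f 2) x = 0" "\<And>x. tri v (f 2) x = 0" "\<And>x. tri u (f 4) x = 0" "\<And>x. tri v (f 3) x = 0"
    "tri u (f 3) (f 5) = 1" "tri v (f 4) (f 5) = 1"
    "tri (f 2) (f 3) (f 5) = 0" "tri (f 2) (f 4) (f 5) = 0" "tri (f 3) (f 4) (f 5) = 0"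
    using red unfolding reduced_vectors_def by blast+
  have uv: "tri u v x = 0" for x by (rule tri_derived[OF L3' r(1,2)])
  have u34: "tri u (f 3) (f 4) = 0" using r(5)[of "f 3"] tri_swap_right[of u "f 4" "f 3"] by simp
  obtain e where e: "standard_basis 5 e" "e (X 1) - u \<in> center" "e (Y 1) - v \<in> center"
    "\<And>i. i \<in> {2..5} \<Longrightarrow> e (X i) \<in> center" "\<And>i. i \<in> {2..5} \<Longrightarrow> e (Y i) - f i \<in> center"
    using reduced_vectors_basis[OF dim iso L3 red] by blast
  note fr = coord_frame[OF standard_basis_frame[OF e(1)]]
  \<comment> \<open>\<open>L\<close> numbers the six letters not already known to give central
    vectors: 0 is X 1, and i is Y i for i = 1, ..., 5. \<open>g\<close> lists their representatives
    modulo the center in the same order.\<close>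
  define L where "L i = (if i = 0 then X 1 else Y i)" for i
  define g where "g i = (if i = 0 then u else if i = 1 then v else f i)" for i
  have Lg: "e (L i) - g i \<in> center" if "i < 6" for i
    using e(2,3) e(5)[of i] that by (auto simp: L_def g_def)
  have L5: "L i \<in> letters 5" if "i < 6" for i
    using that by (auto simp: L_def letters_def)
  \<comment> \<open>The defect \<open>D\<close> is alternating in the indices, so the 20 increasing
    triples suffice.\<close>
  define D where "D i j k = tri (e (L i)) (e (L j)) (e (L k))
    - shape (coord e (e (L i))) (coord e (e (L j))) (coord e (e (L k)))" for i j k
  have D_cyc: "D i j k = D j k i" for i j k
    unfolding D_def tri_cycle[of "e (L i)"] by (simp add: shape_def det3_def algebra_simps)
  have D_swap: "D j i k = - D i j k" for i j k
    unfolding D_def tri_swap[of "e (L j)" "e (L i)"] by (simp add: shape_def det3_def algebra_simps)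
  have D_same: "D i i k = 0" for i k
    unfolding D_def by (simp add: shape_def det3_def algebra_simps)
  have D_sorted: "D i j k = 0" if "i < j" "j < k" "k < 6" for i j k
  proof -
    have "tri (e (L i)) (e (L j)) (e (L k)) = tri (g i) (g j) (g k)"
      using that by (intro tri_cong_center Lg) auto
    moreover have "(i, j, k) \<in> {(0,1,2),(0,1,3),(0,1,4),(0,1,5),(0,2,3),(0,2,4),(0,2,5),(0,3,4),
        (0,3,5),(0,4,5),(1,2,3),(1,2,4),(1,2,5),(1,3,4),(1,3,5),(1,4,5),(2,3,4),(2,3,5),(2,4,5),(3,4,5)}"
    proof -
      have "k = 2 \<or> k = 3 \<or> k = 4 \<or> k = 5" "j = 1 \<or> j = 2 \<or> j = 3 \<or> j = 4"
        "i = 0 \<or> i = 1 \<or> i = 2 \<or> i = 3" using that by linarith+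
      with that(1,2) show ?thesis by (elim disjE) simp_all
    qed
    ultimately show ?thesis
      unfolding D_def insert_iff empty_iff
      by (elim disjE)
        (simp_all add: g_def L_def uv r u34 one shape_def det3_def fr letters_5_mem del: One_nat_def)
  qed
  have D0: "D i j k = 0" if "i < 6" "j < 6" "k < 6" for i j k
  proof -
    consider "i = j" | "j = k" | "i = k" | "i < j" "j < k" | "i < k" "k < j" | "j < i" "i < k"
      | "j < k" "k < i" | "k < i" "i < j" | "k < j" "j < i"
      by linarith
    then show ?thesis
    proof cases
      case 1 then show ?thesis by (simp add: D_same)
    next
      case 2 then show ?thesis using D_cyc[of i j j] by (simp add: D_same)
    next
      case 3 then show ?thesis using D_cyc[of j i i] D_cyc[of i j i] by (simp add: D_same)
    next
      case 4 then show ?thesis using D_sorted that by blast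
    next
      case 5
      then show ?thesis using D_sorted[of i k j] D_cyc[of i j k] D_cyc[of j k i] D_swap[of k i j] that
          D_cyc[of i k j] D_cyc[of k j i] by simp
    next
      case 6 then show ?thesis using D_sorted[of j i k] D_swap[of i j k] that by simp
    next
      case 7 then show ?thesis using D_sorted[of j k i] D_cyc[of i j k] that by simp
    next
      case 8 then show ?thesis using D_sorted[of k i j] D_cyc[of k i j] that by simp
    next
      case 9
      then show ?thesis using D_sorted[of k j i] D_cyc[of i j k] D_cyc[of j k i] D_swap[of j k i] that by simp
    qed
  qed
  have letters_cases: "(\<exists>i\<in>{2..5}. l = X i) \<or> (\<exists>i<6. l = L i)" if "l \<in> letters 5" for l
  proof -
    have "X 1 = L 0" "Y 1 = L 1" "Y 2 = L 2" "Y 3 = L 3" "Y 4 = L 4" "Y 5 = L 5"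
      by (simp_all add: L_def)
    moreover have "(0::nat) < 6" "(1::nat) < 6" "(2::nat) < 6" "(3::nat) < 6" "(4::nat) < 6" "(5::nat) < 6"
      by simp_all
    ultimately show ?thesis
      by (cases rule: letters_5_cases[OF that]) metis+
  qed
  have "presented_by e"
  proof (rule presented_by_basisI[OF e(1)])
    fix a b c assume abc: "a \<in> letters 5" "b \<in> letters 5" "c \<in> letters 5"
    show "tri (e a) (e b) (e c) = shape (coord e (e a)) (coord e (e b)) (coord e (e c))"
    proof (cases "(\<exists>i<6. a = L i) \<and> (\<exists>i<6. b = L i) \<and> (\<exists>i<6. c = L i)")
      case True
      then show ?thesis using D0 unfolding D_def by fastforce
    next
      case False
      \<comment> \<open>Such a letter gives a central vector, so T vanishes; it also has no
        coordinate that occurs in \<open>shape\<close>.\<close>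
      then obtain i where i: "i \<in> {2..5}" "a = X i \<or> b = X i \<or> c = X i"
        using letters_cases[OF abc(1)] letters_cases[OF abc(2)] letters_cases[OF abc(3)] by blast
      have z: "coord e (e (X i)) l = 0" if "l \<in> {X 1, Y 1, Y 2, Y 3, Y 4, Y 5}" for l
      proof -
        have "l \<in> letters 5" "X i \<in> letters 5" "X i \<noteq> l" using that i(1) by (auto simp: letters_def)
        then show ?thesis by (simp add: fr)
      qed
      from i(2) show ?thesis
        by (elim disjE) (simp_all add: tri_center[OF e(4)[OF i(1)]] z shape_def det3_def del: One_nat_def)
    qed
  qed
  then show ?thesis by blast
qed

lemma reduced_vectors_exist:
  assumes e: "standard_basis 5 e" "\<And>i. i \<in> {2..5} \<Longrightarrow> e (X i) \<in> center"
    "e (X 1) \<in> orth center" "e (Y 1) \<in> orth center"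
    "\<And>w x. w \<in> orth center \<Longrightarrow> tri w (e (Y 2)) x = 0"
    and iso: "isotropic center" and L3: "lower_power 3 \<subset> center"
  shows "\<exists>u v f. reduced_vectors u v f"
proof -
  have L3': "lower_power 3 \<subseteq> center" using L3 by blast
  define u v y2 y3 y4 y5 where "u = e (X 1)" and "v = e (Y 1)" and "y2 = e (Y 2)"
    and "y3 = e (Y 3)" and "y4 = e (Y 4)" and "y5 = e (Y 5)"
  note y = u_def v_def y2_def y3_def y4_def y5_def
  have frame: "form (e (X i)) (e (Y j)) = (if i = j then 1 else 0)"
    if "i \<in> {1..5}" "j \<in> {1..5}" for i j
    using standard_basis_frame[OF e(1)] that unfolding symplectic_frame_def by blast
  have form_uv: "form u v = 1" using frame[of 1 1] by (simp add: y del: One_nat_def)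
  have orth_uv: "u \<in> orth center" "v \<in> orth center" using e(3,4) by (simp_all add: y)
  have uv: "tri u v x = 0" "tri v u x = 0" for x
    by (rule tri_derived[OF L3' orth_uv], rule tri_derived[OF L3' orth_uv(2,1)])
  have y2: "tri u y2 x = 0" "tri v y2 x = 0" for x
    using e(5)[OF e(3)] e(5)[OF e(4)] by (simp_all add: y)
  have zero': "tri u x v = 0" "tri v x u = 0" "tri u x y2 = 0" "tri v x y2 = 0" for x
    using uv y2 tri_swap_right[of u x] tri_swap_right[of v x] by simp_all
  define a b c where "a = tri u y3 y4" and "b = tri u y3 y5" and "c = tri u y4 y5"
  note abc = a_def b_def c_def
  define a' b' c' where "a' = tri v y3 y4" and "b' = tri v y3 y5" and "c' = tri v y4 y5"
  note abc' = a'_def b'_def c'_def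
  have U: "tri u y3 y4 = a" "tri u y3 y5 = b" "tri u y4 y5 = c"
    "tri u y4 y3 = - a" "tri u y5 y3 = - b" "tri u y5 y4 = - c"
    using tri_swap_right[of u y4 y3] tri_swap_right[of u y5 y3] tri_swap_right[of u y5 y4] by (simp_all add: abc)
  have V: "tri v y3 y4 = a'" "tri v y3 y5 = b'" "tri v y4 y5 = c'"
    "tri v y4 y3 = - a'" "tri v y5 y3 = - b'" "tri v y5 y4 = - c'"
    using tri_swap_right[of v y4 y3] tri_swap_right[of v y5 y3] tri_swap_right[of v y5 y4] by (simp_all add: abc')
  \<comment> \<open>Identities with a free argument reduce to six evaluations, because central
    arguments contribute nothing.\<close>
  have functional: "h x = 0"
    if "\<And>x y. h (x + y) = h x + h y" "\<And>c x. h (scale c x) = c * h x" "\<And>z. z \<in> center \<Longrightarrow> h z = 0"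
      "h u = 0" "h v = 0" "h y2 = 0" "h y3 = 0" "h y4 = 0" "h y5 = 0" for h :: "'v \<Rightarrow> 'f" and x
  proof (rule functional_eq_0_on_basis[OF e(1)])
    show "h (e l) = 0" if l: "l \<in> letters 5" for l
      using l by (cases rule: letters_5_cases)
        (simp_all add: y[symmetric] e(2) \<open>\<And>z. z \<in> center \<Longrightarrow> h z = 0\<close> \<open>h u = 0\<close> \<open>h v = 0\<close>
          \<open>h y2 = 0\<close> \<open>h y3 = 0\<close> \<open>h y4 = 0\<close> \<open>h y5 = 0\<close> del: One_nat_def)
  qed (fact that)+
  \<comment> \<open>\<open>p\<close> and \<open>q\<close> span the radicals of the alternating forms \<open>tri u\<close> and \<open>tri v\<close> on the span of
    \<open>y3\<close>, \<open>y4\<close>, \<open>y5\<close>.\<close>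
  define p where "p = scale c y3 - scale b y4 + scale a y5"
  define q where "q = scale c' y3 - scale b' y4 + scale a' y5"
  have up: "tri u p x = 0" for x
    by (rule functional) (simp_all add: p_def tri_linear tri_diff zero' U mult.commute tri_center)
  have vq: "tri v q x = 0" for x
    by (rule functional) (simp_all add: q_def tri_linear tri_diff zero' V mult.commute tri_center)
  \<comment> \<open>The mixed term of the radical identity for s u + t v; it ties the later scalings
    of \<open>p\<close> and \<open>q\<close> together.\<close>
  have vp: "tri v p x = - tri u q x" for x
  proof -
    have "tri v p x + tri u q x = 0"
      by (rule functional) (simp_all add: p_def q_def tri_linear tri_diff zero' U V algebra_simps tri_center)
    then show ?thesis by (simp add: eq_neg_iff_add_eq_0)
  qed
  \<comment> \<open>A central combination of \<open>u\<close> and \<open>v\<close> is orthogonal to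
    both, and (u, v) = 1 then forces both coefficients to be 0.\<close>
  have indep: "s = 0 \<and> t = 0"
    if "s * a + t * a' = 0" "s * b + t * b' = 0" "s * c + t * c' = 0" for s t
  proof -
    define w where "w = scale s u + scale t v"
    have "w \<in> center"
      by (rule center_by_basis[OF e(1,2)])
        (simp_all add: y[symmetric] w_def tri_linear uv y2 U V that del: One_nat_def)
    then have "form w u = 0" "form w v = 0" using orth_uv by (simp_all add: orth_def)
    then show ?thesis
      using form_uv form_antisym[of v u] by (simp add: w_def bilinear_simps form_alternating)
  qed
  \<comment> \<open>If T(u, q, -) vanished, so would all 2x2 minors of the rows (a, b, c) and (a',
    b', c'). Then (a', -a), (b', -b) and (c', -c) are coefficient pairs of vanishing combinations of
    the rows, so both rows are zero, against independence.\<close>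
  have "\<exists>z. tri u q z \<noteq> 0"
  proof (rule ccontr)
    assume "\<not> ?thesis"
    then have 0: "tri u q z = 0" for z by blast
    have minors: "a * b' = a' * b" "a * c' = a' * c" "b * c' = b' * c"
      using 0[of y3] 0[of y4] 0[of y5] by (simp_all add: q_def tri_linear tri_diff U algebra_simps)
    have "a' = 0 \<and> - a = 0"
      by (rule indep) (use minors in \<open>simp_all add: algebra_simps\<close>)
    moreover have "b' = 0 \<and> - b = 0"
      by (rule indep) (use minors in \<open>simp_all add: algebra_simps\<close>)
    moreover have "c' = 0 \<and> - c = 0"
      by (rule indep) (use minors in \<open>simp_all add: algebra_simps\<close>)
    ultimately show False using indep[of 1 0] by simp
  qed
  then obtain z where z: "tri u q z \<noteq> 0" by blast
  define m where "m = tri u q z"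
  have m: "m \<noteq> 0" using z by (simp add: m_def)
  \<comment> \<open>The vector \<open>z\<close> takes the place of y5. The opposite signs of the two
    scalings come from T(v, p, z) = - T(u, q, z) = - m.\<close>
  define f3 where "f3 = scale (inverse m) q"
  define f4 where "f4 = scale (- inverse m) p"
  have u4: "tri u f4 x = 0" for x
    unfolding f4_def tri_linear by (simp add: up)
  have v3: "tri v f3 x = 0" for x
    unfolding f3_def tri_linear by (simp add: vq)
  have u3z: "tri u f3 z = 1" using m by (simp add: f3_def tri_linear m_def)
  have v4z: "tri v f4 z = 1" using m unfolding f4_def tri_linear by (simp add: vp m_def)
  \<comment> \<open>As T(v, f4, z) = 1, this multiple of \<open>v\<close> cancels T(f3, f4, z). T(u,
    f3, -) and T(v, f3, -) are unaffected because T(u, v, -) = T(v, v, -) = 0.\<close>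
  define f3' where "f3' = f3 - scale (tri f3 f4 z) v"
  \<comment> \<open>At the pairs (f3', z) and (f4, z) the form of \<open>u\<close> has values 1, 0
    and that of \<open>v\<close> has values 0, 1, so the two multiples cancel the two values of
    T(y2, -, z) independently.\<close>
  define f2 where "f2 = y2 - scale (tri y2 f3' z) u - scale (tri y2 f4 z) v"
  have y2v: "tri y2 v x = 0" "tri y2 u x = 0" for x
    using y2 tri_swap[of v y2 x] tri_swap[of u y2 x] by simp_all
  \<comment> \<open>Only the indices 2 to 5 matter; the value 0 elsewhere is a dummy.\<close>
  define f :: "nat \<Rightarrow> 'v" where "f = (\<lambda>_. 0)(2 := f2, 3 := f3', 4 := f4, 5 := z)"
  have f: "f 2 = f2" "f 3 = f3'" "f 4 = f4" "f 5 = z" by (simp_all add: f_def)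
  \<comment> \<open>Since \<open>u\<close> and \<open>v\<close> are orthogonal to the center,
    \<open>f2\<close> still has the pairing 1 of \<open>y2\<close> with the central vector
    \<open>e (X 2)\<close>.\<close>
  have "f2 \<notin> orth center"
  proof
    assume "f2 \<in> orth center"
    then have "form (e (X 2)) f2 = 0" using e(2)[of 2] by (simp add: orth_def)
    moreover have "form (e (X 2)) u = 0" "form (e (X 2)) v = 0"
      using orth_uv e(2)[of 2] by (simp_all add: orth_def)
    moreover have "form (e (X 2)) y2 = 1" using frame[of 2 2] by (simp add: y)
    ultimately show False by (simp add: f2_def form_diff_right form_scale_right)
  qed
  moreover have "tri u f2 x = 0" "tri v f2 x = 0" "tri v f3' x = 0" for x
    by (simp_all add: f2_def f3'_def tri_diff tri_linear y2 uv v3)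
  moreover have u3z': "tri u f3' z = 1"
    by (simp add: f3'_def tri_diff tri_linear uv u3z)
  moreover have "tri f3' f4 z = 0"
    by (simp add: f3'_def tri_diff tri_linear v4z)
  moreover have "tri f2 f3' z = 0"
    using \<open>tri v f3' z = 0\<close> by (simp add: f2_def tri_diff tri_linear u3z')
  moreover have "tri f2 f4 z = 0"
    by (simp add: f2_def tri_diff tri_linear u4 v4z)
  ultimately have "reduced_vectors u v f"
    unfolding reduced_vectors_def f using orth_uv form_uv u4 v4z by blast
  then show ?thesis by blast
qed

text \<open>Rescaling \<open>f 2\<close> brings the one remaining parameter to 1. The other values
  of T involving \<open>f 2\<close> are 0, so they persist.\<close>

lemma nilpotent_saa_10_4_1_imp_presented:
  assumes "nilpotent_saa_10_4_1 scale form (\<bullet>\<^sub>L)"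
  shows "\<exists>e. presented_by e"
proof -
  have dim: "dim (UNIV :: 'v set) = 10" and iso: "isotropic center" and dimZ: "dim center = 4"
    and L3: "lower_power 3 \<subset> center"
    using assms unfolding nilpotent_saa_10_4_1_def by blast+
  have "\<exists>u v f. reduced_vectors u v f"
    by (rule adapted_basis[OF dim iso dimZ L3]) (rule reduced_vectors_exist[OF _ _ _ _ _ iso L3])
  then obtain u v f where red: "reduced_vectors u v f" by blast
  define k where "k = tri (f 2) (f 3) (f 4)"
  have k: "k \<noteq> 0" unfolding k_def by (rule reduced_vectors_nonzero[OF dim iso L3 red])
  define f' where "f' = f(2 := scale (inverse k) (f 2))"
  have f': "f' 2 = scale (inverse k) (f 2)" "f' 3 = f 3" "f' 4 = f 4" "f' 5 = f 5"
    by (simp_all add: f'_def)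
  have "f' 2 \<notin> orth center"
  proof
    assume "f' 2 \<in> orth center"
    then have "scale k (f' 2) \<in> orth center" by (rule subspace_scale[OF subspace_orth])
    then show False using red k by (simp add: f' reduced_vectors_def)
  qed
  then have "reduced_vectors u v f'"
    using red unfolding reduced_vectors_def f' by (simp add: tri_linear)
  moreover have "tri (f' 2) (f' 3) (f' 4) = 1"
    using k by (simp add: f' tri_linear k_def)
  ultimately show ?thesis
    by (rule reduced_vectors_presented[OF dim iso L3])
qed

end

lemma nilpotent_saa_10_4_1_isomorphic:
  assumes "nilpotent_saa_10_4_1 sc form mul" "nilpotent_saa_10_4_1 sc' form' mul'"
  shows "saa_isomorphic sc form mul sc' form' mul'"
proof -
  have S: "symplectic_alternating_algebra sc form mul" "symplectic_alternating_algebra sc' form' mul'"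
    using assms by (simp_all add: nilpotent_saa_10_4_1_def)
  then obtain e e' where "symplectic_alternating_algebra.presented_by sc form mul e"
    "symplectic_alternating_algebra.presented_by sc' form' mul' e'"
    using symplectic_alternating_algebra.nilpotent_saa_10_4_1_imp_presented assms by metis
  then show ?thesis using presented_imp_isomorphic S by blast
qed

text \<open>Existence is asserted on a concrete ten-dimensional space, because for arbitrary carrier
  types the uniqueness statement could hold vacuously.\<close>

theorem proposition2p1:
  shows "(\<exists>(form :: 'f::field ^ 10 \<Rightarrow> 'f ^ 10 \<Rightarrow> 'f) mul. nilpotent_saa_10_4_1 (*s) form mul) \<and>
    (\<forall>(sc :: 'f \<Rightarrow> 'v::ab_group_add \<Rightarrow> 'v) form mul
      (sc' :: 'f \<Rightarrow> 'w::ab_group_add \<Rightarrow> 'w) form' mul'.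
        nilpotent_saa_10_4_1 sc form mul \<longrightarrow> nilpotent_saa_10_4_1 sc' form' mul' \<longrightarrow>
        saa_isomorphic sc form mul sc' form' mul') \<and>
    (\<forall>(sc :: 'f \<Rightarrow> 'v \<Rightarrow> 'v) form mul.
        symplectic_alternating_algebra sc form mul \<longrightarrow>
        (nilpotent_saa_10_4_1 sc form mul \<longleftrightarrow>
         symplectic_alternating_algebra.has_nilpotent_presentation sc form mul 5 P10_4_1))"
proof (intro conjI allI impI)
  show "\<exists>(form :: 'f ^ 10 \<Rightarrow> 'f ^ 10 \<Rightarrow> 'f) mul. nilpotent_saa_10_4_1 (*s) form mul"
    using ex_presented_algebra symplectic_alternating_algebra.presented_by_imp_nilpotent_saa_10_4_1
    by metis
next
  fix sc :: "'f \<Rightarrow> 'v \<Rightarrow> 'v" and form mul and sc' :: "'f \<Rightarrow> 'w \<Rightarrow> 'w" and form' mul'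
  assume "nilpotent_saa_10_4_1 sc form mul" "nilpotent_saa_10_4_1 sc' form' mul'"
  then show "saa_isomorphic sc form mul sc' form' mul'"
    by (rule nilpotent_saa_10_4_1_isomorphic)
next
  fix sc :: "'f \<Rightarrow> 'v \<Rightarrow> 'v" and form mul
  assume "symplectic_alternating_algebra sc form mul"
  then interpret symplectic_alternating_algebra sc form mul .
  show "nilpotent_saa_10_4_1 sc form mul \<longleftrightarrow> has_nilpotent_presentation 5 P10_4_1"
    using nilpotent_saa_10_4_1_imp_presented presented_by_imp_nilpotent_saa_10_4_1
    unfolding has_nilpotent_presentation_iff by blast
qed

end
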